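(* Let $P$ be an unknown probability distribution on $\{0,1\}^n$, accessed through i.i.d. samples, and let $\varepsilon\in(0,1]$. (i) Let $G$ be a given (known) directed acyclic graph on $n$ vertices with maximum in-degree at most $d$. It takes at most $$O\left(\max\left(\frac{2^{n/2}}{\varepsilon^2},\ \frac{2^d n^2 d\log (n)}{\varepsilon^2}\right)\right)$$ i.i.d. samples from $P$ to test whether $d_H(P,G)=0$ or $d_H(P,G)\ge\varepsilon$, with success probability at least $2/3$. (ii) Furthermore, testing whether $P$ is Markov with respect to any (i.e. some) directed acyclic graph on $n$ vertices of maximum in-degree at most $d$, with success probability at least $2/3$, takes at most $$O\left(\max\left(\frac{2^{n/2}}{\varepsilon^2},\ \frac{2^d n^2 d\log (n)}{\varepsilon^2}\right)\cdot\log\left(n^{dn}\right)\right)$$ i.i.d. samples from $P$.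
   Context: For a directed acyclic graph (DAG) $G$ on vertex set $[n]$, with $\Pi_i$ the set of parents of $i$, a distribution $Q$ of $(X_1,\dots,X_n)\in\{0,1\}^n$ is Markov with respect to $G$ (a Bayes net on $G$) if $Q(x)=\prod_{i=1}^n Q(x_i\mid \pi_i(x))$, where $\pi_i(x)$ is the restriction of $x$ to the coordinates in $\Pi_i$. The Hellinger distance is given by $d_H^2(P,Q)=\frac12\sum_{x}\left(\sqrt{P(x)}-\sqrt{Q(x)}\right)^2$, and $d_H(P,G)=\inf\{d_H(P,Q): Q \text{ is Markov with respect to } G\}$. Testing with success probability at least $2/3$ in (i) means that there is an algorithm which, from the samples, accepts with probability at least $2/3$ if $d_H(P,G)=0$ and rejects with probability at least $2/3$ if $d_H(P,G)\ge\varepsilon$. In (ii) it means that the algorithm accepts with probability at least $2/3$ if $d_H(P,G)=0$ for some DAG $G$ on $n$ vertices of maximum in-degree at most $d$, and rejects with probability at least $2/3$ if $d_H(P,G)\ge\varepsilon$ for every such DAG $G$. If neither case holds, any output is allowed. There is no restriction on running time. The constants in $O(\cdot)$ are absolute.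
   Formalization: Part (ii) is stated for d ≥ 1 only: for d = 0 the printed bound is 0 because log(n^0) = 0, and with no samples one cannot tell a product law from the perfectly correlated law when n = 2 and ε = 1/2. Part (i) keeps d = 0. *)

theory Defs
  imports "HOL-Probability.Probability"
begin

text \<open>
  Points of $\{0,1\}^n$ are Boolean functions on $[n] = \{1,\dots,n\}$, extended by \<open>undefined\<close>
  outside $[n]$. Since the constants in the sample bounds are uniform in $n$, the dimension is a
  natural number and not a type.
\<close>

definition cube :: "nat \<Rightarrow> (nat \<Rightarrow> bool) set" where
  "cube n = {1..n} \<rightarrow>\<^sub>E UNIV"

definition distributions :: "nat \<Rightarrow> (nat \<Rightarrow> bool) pmf set" where
  "distributions n = {P. set_pmf P \<subseteq> cube n}"

text \<open>A directed graph on $[n]$ is its edge relation; \<open>(j, i) \<in> G\<close> is the edge from $j$ to $i$.\<close>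

definition parents :: "(nat \<times> nat) set \<Rightarrow> nat \<Rightarrow> nat set" where
  "parents G i = {j. (j, i) \<in> G}"

definition dags :: "nat \<Rightarrow> nat \<Rightarrow> (nat \<times> nat) set set" where
  "dags n d = {G. G \<subseteq> {1..n} \<times> {1..n} \<and> acyclic G \<and> (\<forall>i\<in>{1..n}. card (parents G i) \<le> d)}"

text \<open>
  \<open>cond_prob\<close> is $0$ when the conditioning event is null. This choice is immaterial: if
  $Q(\pi_i(x)) = 0$ for some $i$, then $Q(x) = 0$ as well.
\<close>

definition markov :: "nat \<Rightarrow> (nat \<times> nat) set \<Rightarrow> (nat \<Rightarrow> bool) pmf \<Rightarrow> bool" where
  "markov n G Q \<longleftrightarrow> (\<forall>x\<in>cube n. pmf Q x =
     (\<Prod>i\<in>{1..n}. \<P>(y in measure_pmf Q. y i = x i \<bar>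
        restrict y (parents G i) = restrict x (parents G i))))"

definition hellinger :: "nat \<Rightarrow> (nat \<Rightarrow> bool) pmf \<Rightarrow> (nat \<Rightarrow> bool) pmf \<Rightarrow> real" where
  "hellinger n P Q = sqrt (1 / 2 * (\<Sum>x\<in>cube n. (sqrt (pmf P x) - sqrt (pmf Q x))\<^sup>2))"

definition hellinger_graph :: "nat \<Rightarrow> (nat \<Rightarrow> bool) pmf \<Rightarrow> (nat \<times> nat) set \<Rightarrow> real" where
  "hellinger_graph n P G = (INF Q\<in>{Q \<in> distributions n. markov n G Q}. hellinger n P Q)"

text \<open>
  A randomised tester maps the list of samples to a random verdict, \<open>True\<close> meaning acceptance.
  It must not depend on the unknown \<open>P\<close>; it may depend on everything else. Nothing is required
  of it on distributions satisfying neither \<open>Yes\<close> nor \<open>No\<close>.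
\<close>

definition testable_with ::
  "nat \<Rightarrow> nat \<Rightarrow> ((nat \<Rightarrow> bool) pmf \<Rightarrow> bool) \<Rightarrow> ((nat \<Rightarrow> bool) pmf \<Rightarrow> bool) \<Rightarrow> bool" where
  "testable_with n m Yes No \<longleftrightarrow>
     (\<exists>T :: (nat \<Rightarrow> bool) list \<Rightarrow> bool pmf. \<forall>P\<in>distributions n.
        (Yes P \<longrightarrow> pmf (bind_pmf (replicate_pmf m P) T) True \<ge> 2 / 3) \<and>
        (No P \<longrightarrow> pmf (bind_pmf (replicate_pmf m P) T) False \<ge> 2 / 3))"

definition sample_bound :: "nat \<Rightarrow> nat \<Rightarrow> real \<Rightarrow> real" where
  "sample_bound n d \<epsilon> =
     max (2 powr (real n / 2) / \<epsilon>\<^sup>2) (2 ^ d * (real n)\<^sup>2 * real d * ln (real n) / \<epsilon>\<^sup>2)"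

end

theory Submission
  imports Defs
begin

text \<open>
  Learn, then test. From independent batches, one per node, every conditional probability is
  estimated by its add-one smoothed frequency; the product \<open>Q\<close> of the estimates is Markov with
  respect to \<open>G\<close>, whatever \<open>P\<close> is. If \<open>P\<close> is Markov, then on the set \<open>A\<close> of points all of whose
  parent configurations have been seen at least \<open>n\<close> times, \<open>E (\<Sum>x\<in>A. P(x)\<^sup>2 / Q(x))\<close> factorises over
  the nodes, so \<open>Q\<close> is close to \<open>P\<close> in chi-square distance on \<open>A\<close>, and the complement of \<open>A\<close> is
  light under both \<open>P\<close> and \<open>Q\<close>; this takes \<open>O(n\<^sup>3 2\<^sup>d / \<epsilon>\<^sup>2)\<close> samples, which the claimed bound
  dominates. If \<open>P\<close> is far from every Markov distribution, then it is far from \<open>Q\<close>. The two cases are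
  told apart by the bilinear statistic \<open>\<Sum>x\<in>A. (X\<^sub>x - m Q(x)) (Y\<^sub>x - m Q(x)) / (Q(x) + \<theta>)\<close> of the counts
  of two independent samples, where \<open>\<theta>\<close> is of order \<open>\<epsilon>\<^sup>2 / 2\<^sup>n\<close>: its mean is \<open>m\<^sup>2\<close> times a truncated
  chi-square distance, and its variance is under control as soon as \<open>m\<close> is of order \<open>2 powr (n / 2) / \<epsilon>\<^sup>2\<close>.
  For an unknown graph, the majority vote of repeated tests makes the error small enough for a union
  bound over the at most \<open>n ^ (d * n)\<close> graphs.
\<close>

section \<open>Expectations over finitely supported samples\<close>

abbreviation E :: "'a pmf \<Rightarrow> ('a \<Rightarrow> real) \<Rightarrow> real" where
  "E p f \<equiv> measure_pmf.expectation p f"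

abbreviation hits :: "('a \<Rightarrow> bool) \<Rightarrow> 'a list \<Rightarrow> nat" where
  "hits B ys \<equiv> length (filter B ys)"

section \<open>Elementary rules for expectations and tail bounds\<close>

lemma E_conv_sum:
  assumes "finite A" "set_pmf p \<subseteq> A"
  shows "E p f = (\<Sum>a\<in>A. pmf p a * f a)"
  using integral_measure_pmf[OF assms(1), of p f] assms(2) by auto

lemma E_mono:
  assumes "finite (set_pmf p)" "\<And>x. x \<in> set_pmf p \<Longrightarrow> f x \<le> g x"
  shows "E p f \<le> E p g"
  using assms by (intro integral_mono_AE integrable_measure_pmf_finite) (auto simp: AE_measure_pmf_iff)

lemma E_cong:
  assumes "\<And>x. x \<in> set_pmf p \<Longrightarrow> f x = g x"
  shows "E p f = E p g"
  using assms by (intro integral_cong_AE) (auto simp: AE_measure_pmf_iff)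

lemma E_add:
  assumes "finite (set_pmf p)"
  shows "E p (\<lambda>x. f x + g x) = E p f + E p g"
  using assms by (intro Bochner_Integration.integral_add integrable_measure_pmf_finite)

lemma E_diff:
  assumes "finite (set_pmf p)"
  shows "E p (\<lambda>x. f x - g x) = E p f - E p g"
  using assms by (intro Bochner_Integration.integral_diff integrable_measure_pmf_finite)

lemma E_sum:
  assumes "finite (set_pmf p)"
  shows "E p (\<lambda>x. \<Sum>i\<in>I. f i x) = (\<Sum>i\<in>I. E p (f i))"
  using assms by (intro Bochner_Integration.integral_sum integrable_measure_pmf_finite)

lemma E_nonneg: "(\<And>x. x \<in> set_pmf p \<Longrightarrow> 0 \<le> f x) \<Longrightarrow> 0 \<le> E p f"
  by (intro integral_nonneg_AE) (auto simp: AE_measure_pmf_iff)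

lemma prob_conv_E: "measure_pmf.prob p {x. Q x} = E p (\<lambda>x. of_bool (Q x))"
proof -
  have "(\<lambda>x. of_bool (Q x) :: real) = indicator {x. Q x}"
    by (auto simp: indicator_def)
  then show ?thesis by simp
qed

lemma markov_ineq:
  assumes "finite (set_pmf p)" "\<And>x. x \<in> set_pmf p \<Longrightarrow> 0 \<le> f x" "0 < t"
  shows "measure_pmf.prob p {x. t \<le> f x} \<le> E p f / t"
proof -
  have "E p (\<lambda>x. of_bool (t \<le> f x)) \<le> E p (\<lambda>x. f x / t)"
    using assms by (intro E_mono) (auto simp: field_simps)
  then show ?thesis
    by (simp add: prob_conv_E)
qed

lemma chebyshev_ineq:
  fixes f :: "'a \<Rightarrow> real"
  assumes "finite (set_pmf p)" "0 < t"
  shows "measure_pmf.prob p {x. t \<le> \<bar>f x - E p f\<bar>} \<le> (E p (\<lambda>x. (f x)\<^sup>2) - (E p f)\<^sup>2) / t\<^sup>2"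
proof -
  let ?\<mu> = "E p f"
  have "{x. t \<le> \<bar>f x - ?\<mu>\<bar>} = {x. t\<^sup>2 \<le> (f x - ?\<mu>)\<^sup>2}"
    using assms(2) by (auto simp: abs_le_square_iff[symmetric])
  then have "measure_pmf.prob p {x. t \<le> \<bar>f x - ?\<mu>\<bar>} \<le> E p (\<lambda>x. (f x - ?\<mu>)\<^sup>2) / t\<^sup>2"
    using markov_ineq[OF assms(1), of "\<lambda>x. (f x - ?\<mu>)\<^sup>2" "t\<^sup>2"] assms(2) by simp
  also have "E p (\<lambda>x. (f x - ?\<mu>)\<^sup>2) = E p (\<lambda>x. (f x)\<^sup>2 + ?\<mu>\<^sup>2 - 2 * ?\<mu> * f x)"
    by (simp add: power2_diff algebra_simps)
  also have "\<dots> = E p (\<lambda>x. (f x)\<^sup>2) - ?\<mu>\<^sup>2"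
    by (simp add: E_add E_diff assms(1) power2_eq_square)
  finally show ?thesis .
qed

lemma prob_Un_le: "measure_pmf.prob p {x. A x \<or> B x} \<le> measure_pmf.prob p {x. A x} + measure_pmf.prob p {x. B x}"
proof -
  have "{x. A x \<or> B x} = {x. A x} \<union> {x. B x}" by auto
  then show ?thesis
    by (simp add: measure_Un_le)
qed

section \<open>Independent samples and size-biased counts\<close>

lemma E_bind:
  assumes "finite (set_pmf p)" "\<And>x. x \<in> set_pmf p \<Longrightarrow> finite (set_pmf (f x))"
  shows "E (bind_pmf p f) h = E p (\<lambda>x. E (f x) h)"
  using pmf_expectation_bind[where A = "set_pmf p" and p = p and f = f and h = h] assms E_conv_sum[OF assms(1), of p "\<lambda>x. E (f x) h"]
  by simp

lemma finite_set_replicate_pmf: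
  "finite (set_pmf p) \<Longrightarrow> finite (set_pmf (replicate_pmf m p))"
  unfolding set_replicate_pmf using finite_lists_length_eq[of "set_pmf p" m]
  by (simp add: lists_eq_set conj_commute Collect_conj_eq Int_commute)

lemma E_replicate_0 [simp]: "E (replicate_pmf 0 p) F = F []"
  by simp

lemma E_replicate_Suc:
  assumes "finite (set_pmf p)"
  shows "E (replicate_pmf (Suc m) p) F = E p (\<lambda>y. E (replicate_pmf m p) (\<lambda>ys. F (y # ys)))"
  using assms by (simp add: E_bind finite_set_replicate_pmf)

lemma E_pair:
  assumes "finite (set_pmf p)" "finite (set_pmf q)"
  shows "E (pair_pmf p q) F = E p (\<lambda>x. E q (\<lambda>y. F (x, y)))"
  unfolding pair_pmf_def using assms by (simp add: E_bind)

lemma E_prod_replicate: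
  fixes f :: "nat \<Rightarrow> 'a \<Rightarrow> real"
  assumes "finite (set_pmf p)"
  shows "E (replicate_pmf m p) (\<lambda>ys. \<Prod>i<m. f i (ys ! i)) = (\<Prod>i<m. E p (f i))"
proof (induction m arbitrary: f)
  case (Suc m)
  have "E (replicate_pmf (Suc m) p) (\<lambda>ys. \<Prod>i<Suc m. f i (ys ! i))
      = E p (\<lambda>y. f 0 y * E (replicate_pmf m p) (\<lambda>ys. \<Prod>i<m. f (Suc i) (ys ! i)))"
    by (simp add: E_replicate_Suc assms prod.lessThan_Suc_shift del: prod.lessThan_Suc replicate_pmf.simps)
  also have "\<dots> = E p (f 0) * (\<Prod>i<m. E p (f (Suc i)))"
    using Suc.IH[of "\<lambda>i. f (Suc i)"] by simp
  finally show ?case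
    by (simp only: prod.lessThan_Suc_shift)
qed simp

lemma E_nth_replicate:
  fixes f :: "'a \<Rightarrow> real"
  assumes "finite (set_pmf p)" "i < m"
  shows "E (replicate_pmf m p) (\<lambda>ys. f (ys ! i)) = E p f"
proof -
  \<comment> \<open>All factors of the product except the one at \<open>i\<close> are constantly
    1.\<close>
  have "E (replicate_pmf m p) (\<lambda>ys. \<Prod>j<m. (if j = i then f else (\<lambda>_. 1)) (ys ! j)) = (\<Prod>j<m. E p (if j = i then f else (\<lambda>_. 1)))"
    by (rule E_prod_replicate[OF assms(1)])
  also have "(\<lambda>ys. \<Prod>j<m. (if j = i then f else (\<lambda>_. 1)) (ys ! j)) = (\<lambda>ys. \<Prod>j<m. if j = i then f (ys ! j) else 1)"
    by (intro ext prod.cong) auto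
  also have "(\<Prod>j<m. E p (if j = i then f else (\<lambda>_. 1))) = (\<Prod>j<m. if j = i then E p f else 1)"
    by (intro prod.cong) auto
  finally show ?thesis using assms(2) by (simp add: prod.delta)
qed

text \<open>Write the number of hits of \<open>B\<close> as a sum over positions. By exchangeability
  each of the \<open>Suc m\<close> positions contributes the probability of \<open>B\<close> times
  the expectation of \<open>F\<close> on the counts of the other \<open>m\<close> samples. The
  subtractions remove the chosen sample from both counts, which is right because \<open>B\<close>
  implies \<open>D\<close>; when there is no hit, the factor 0 hides the truncated
  subtraction.\<close>

lemma size_bias:
  fixes F :: "nat \<Rightarrow> nat \<Rightarrow> real"
  assumes fin: "finite (set_pmf p)" and sub: "\<And>y. B y \<Longrightarrow> D y"
  shows "E (replicate_pmf (Suc m) p) (\<lambda>ys. real (hits B ys) * F (hits D ys - 1) (hits B ys - 1))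
       = real (Suc m) * measure_pmf.prob p {y. B y} * E (replicate_pmf m p) (\<lambda>ys. F (hits D ys) (hits B ys))"
proof (induction m arbitrary: F)
  case 0
  have "E (replicate_pmf (Suc 0) p) (\<lambda>ys. real (hits B ys) * F (hits D ys - 1) (hits B ys - 1))
     = E p (\<lambda>y. of_bool (B y) * F 0 0)"
    by (simp only: E_replicate_Suc[OF fin] E_replicate_0) (auto intro!: E_cong simp: sub)
  then show ?case by (simp add: prob_conv_E)
next
  case (Suc m)
  define G where "G = (\<lambda>ys. real (hits B ys) * F (hits D ys - 1) (hits B ys - 1))"
  define H where "H = (\<lambda>y k x. F (k + of_bool (D y)) (x + of_bool (B y)))"
  let ?b = "measure_pmf.prob p {y. B y}"
  note fins = finite_set_replicate_pmf[OF fin]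
  have le: "hits B ys \<le> hits D ys" for ys
    using sub by (induction ys) auto
  \<comment> \<open>Either the head is the chosen sample, or a hit in the tail is chosen and
    \<open>H\<close> adds the head back to the counts.\<close>
  have G: "G (y # ys) = of_bool (B y) * F (hits D ys) (hits B ys)
      + real (hits B ys) * H y (hits D ys - 1) (hits B ys - 1)" for y ys
  proof (cases "hits B ys = 0")
    case True
    then show ?thesis using sub by (auto simp: G_def)
  next
    case False
    moreover from this have "hits D ys > 0" using le[of ys] by linarith
    ultimately show ?thesis using sub[of y]
      by (cases "B y"; cases "D y") (auto simp: G_def H_def algebra_simps)
  qed
  have "E (replicate_pmf (Suc (Suc m)) p) G
     = E p (\<lambda>y. of_bool (B y) * E (replicate_pmf (Suc m) p) (\<lambda>ys. F (hits D ys) (hits B ys))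
         + real (Suc m) * ?b * E (replicate_pmf m p) (\<lambda>ys. H y (hits D ys) (hits B ys)))"
    by (simp only: E_replicate_Suc[OF fin, of "Suc m"] G E_add[OF fins] Suc.IH integral_mult_right_zero)
  also have "\<dots> = ?b * E (replicate_pmf (Suc m) p) (\<lambda>ys. F (hits D ys) (hits B ys))
      + real (Suc m) * ?b * E p (\<lambda>y. E (replicate_pmf m p) (\<lambda>ys. H y (hits D ys) (hits B ys)))"
    by (simp add: E_add[OF fin] prob_conv_E del: replicate_pmf.simps)
  also have "E p (\<lambda>y. E (replicate_pmf m p) (\<lambda>ys. H y (hits D ys) (hits B ys)))
      = E (replicate_pmf (Suc m) p) (\<lambda>ys. F (hits D ys) (hits B ys))"
    by (simp only: E_replicate_Suc[OF fin, of m]) (auto intro!: E_cong simp: H_def)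
  finally show ?case unfolding G_def by (simp add: algebra_simps del: replicate_pmf.simps)
qed

text \<open>For this choice of \<open>F\<close> in \<open>size_bias\<close>, the summand is a count
  times its own inverse, hence at most 1.\<close>

lemma E_inverse_hits_le:
  assumes fin: "finite (set_pmf p)"
  shows "real (Suc m) * measure_pmf.prob p {y. D y} * E (replicate_pmf m p) (\<lambda>ys. 1 / (real (hits D ys) + 1)) \<le> 1"
proof -
  have "real (Suc m) * measure_pmf.prob p {y. D y} * E (replicate_pmf m p) (\<lambda>ys. 1 / (real (hits D ys) + 1))
     = E (replicate_pmf (Suc m) p) (\<lambda>ys. real (hits D ys) * (1 / (real (hits D ys - 1) + 1)))"
    using size_bias[OF fin, of D D m "\<lambda>k x. 1 / (real x + 1)"] by (simp del: replicate_pmf.simps)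
  also have "\<dots> \<le> E (replicate_pmf (Suc m) p) (\<lambda>_. 1)"
    by (intro E_mono finite_set_replicate_pmf fin) (auto simp: field_simps)
  finally show ?thesis by simp
qed

text \<open>This controls the mean of a true conditional probability over its smoothed estimate,
  with a weight \<open>h\<close> depending on the parent count. Size bias is used twice: for
  \<open>B\<close> it leaves \<open>h\<close> on the event that \<open>B\<close> is hit, for
  \<open>D\<close> it leaves \<open>h\<close> on the larger event that \<open>D\<close> is hit, and
  the factors \<open>Suc m\<close> cancel.\<close>

lemma E_smoothed_ratio_le:
  fixes h :: "nat \<Rightarrow> real"
  assumes fin: "finite (set_pmf p)" and sub: "\<And>y. B y \<Longrightarrow> D y" and h: "\<And>k. 0 \<le> h k"
    and pos: "measure_pmf.prob p {y. D y} > 0"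
  shows "E (replicate_pmf m p) (\<lambda>ys. measure_pmf.prob p {y. B y} / measure_pmf.prob p {y. D y}
            * h (hits D ys) / (real (hits B ys) + 1))
       \<le> E (replicate_pmf m p) (\<lambda>ys. h (hits D ys) / (real (hits D ys) + 1))"
proof -
  let ?b = "measure_pmf.prob p {y. B y}" and ?w = "measure_pmf.prob p {y. D y}"
  let ?L = "E (replicate_pmf m p) (\<lambda>ys. h (hits D ys) / (real (hits B ys) + 1))"
  let ?R = "E (replicate_pmf m p) (\<lambda>ys. h (hits D ys) / (real (hits D ys) + 1))"
  have le: "hits B ys \<le> hits D ys" for ys
    using sub by (induction ys) auto
  have "real (Suc m) * ?b * ?L
      = E (replicate_pmf (Suc m) p) (\<lambda>ys. real (hits B ys) * (h (hits D ys - 1) / (real (hits B ys - 1) + 1)))"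
    using size_bias[OF fin, of B D m "\<lambda>k x. h k / (real x + 1)"] sub by (simp del: replicate_pmf.simps)
  also have "\<dots> \<le> E (replicate_pmf (Suc m) p) (\<lambda>ys. real (hits D ys) * (h (hits D ys - 1) / (real (hits D ys - 1) + 1)))"
  proof (intro E_mono finite_set_replicate_pmf fin)
    fix ys
    show "real (hits B ys) * (h (hits D ys - 1) / (real (hits B ys - 1) + 1))
       \<le> real (hits D ys) * (h (hits D ys - 1) / (real (hits D ys - 1) + 1))"
      using le[of ys] h[of "hits D ys - 1"] by (cases "hits B ys"; cases "hits D ys") (auto simp: field_simps)
  qed
  also have "\<dots> = real (Suc m) * ?w * ?R"
    using size_bias[OF fin, of D D m "\<lambda>k x. h k / (real k + 1)"] by (simp del: replicate_pmf.simps)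
  finally have "?b * ?L \<le> ?w * ?R"
    by (simp only: mult.assoc mult_le_cancel_left_pos of_nat_0_less_iff zero_less_Suc)
  moreover have "E (replicate_pmf m p) (\<lambda>ys. ?b / ?w * h (hits D ys) / (real (hits B ys) + 1)) = ?b / ?w * ?L"
    by (simp flip: integral_mult_right_zero)
  moreover have "?b / ?w * ?L \<le> ?R" if "?b * ?L \<le> ?w * ?R"
    using that pos by (simp add: divide_le_eq mult.commute)
  ultimately show ?thesis by simp
qed

section \<open>Moments of sums over a sample\<close>

lemma E_sum_list:
  fixes u :: "'a \<Rightarrow> real"
  assumes "finite (set_pmf p)"
  shows "E (replicate_pmf m p) (\<lambda>ys. sum_list (map u ys)) = real m * E p u"
proof (induction m)
  case (Suc m)
  then show ?case
    by (simp add: E_replicate_Suc E_add assms finite_set_replicate_pmf algebra_simps del: replicate_pmf.simps)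
qed simp

text \<open>The \<open>m\<close> pairs of equal positions contribute the mean of the product, all
  others the product of the means; the excess is \<open>m\<close> times the covariance.\<close>

lemma E_sum_list_mult:
  fixes u v :: "'a \<Rightarrow> real"
  assumes "finite (set_pmf p)"
  shows "E (replicate_pmf m p) (\<lambda>ys. sum_list (map u ys) * sum_list (map v ys))
       = (real m)\<^sup>2 * (E p u * E p v) + real m * (E p (\<lambda>y. u y * v y) - E p u * E p v)"
proof (induction m)
  case (Suc m)
  note f = assms finite_set_replicate_pmf[OF assms]
  have "E (replicate_pmf (Suc m) p) (\<lambda>ys. sum_list (map u ys) * sum_list (map v ys))
      = E p (\<lambda>y. E (replicate_pmf m p) (\<lambda>ys. u y * v y + u y * sum_list (map v ys) + v y * sum_list (map u ys)
          + sum_list (map u ys) * sum_list (map v ys)))"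
    by (simp add: E_replicate_Suc f algebra_simps del: replicate_pmf.simps)
  also have "\<dots> = E p (\<lambda>y. u y * v y) + E p u * (real m * E p v) + E p v * (real m * E p u)
      + E (replicate_pmf m p) (\<lambda>ys. sum_list (map u ys) * sum_list (map v ys))"
    by (simp add: E_add f E_sum_list del: replicate_pmf.simps)
  finally show ?case
    unfolding Suc.IH by (simp add: algebra_simps power2_eq_square del: replicate_pmf.simps)
qed simp

section \<open>Cutting one sample into independent batches\<close>

primrec chunks :: "nat \<Rightarrow> nat \<Rightarrow> 'a list \<Rightarrow> 'a list list" where
  "chunks 0 m xs = []"
| "chunks (Suc r) m xs = take m xs # chunks r m (drop m xs)"

lemma bind_replicate_cong:
  assumes "\<And>xs. length xs = m \<Longrightarrow> f xs = g xs"
  shows "bind_pmf (replicate_pmf m p) f = bind_pmf (replicate_pmf m p) g"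
  by (intro bind_pmf_cong) (auto simp: set_replicate_pmf assms)

lemma replicate_pmf_split:
  "map_pmf (\<lambda>xs. (take m xs, drop m xs)) (replicate_pmf (m + k) p) = pair_pmf (replicate_pmf m p) (replicate_pmf k p)"
  unfolding replicate_pmf_distrib pair_pmf_def map_bind_pmf map_return_pmf
  by (rule bind_replicate_cong) simp

text \<open>Supplies independent batches from a single list of samples: one per node in learning,
  one per repetition in the majority vote.\<close>

lemma map_chunks_replicate_pmf:
  "map_pmf (chunks r m) (replicate_pmf (r * m) p) = replicate_pmf r (replicate_pmf m p)"
proof (induction r)
  case (Suc r)
  have "map_pmf (chunks (Suc r) m) (replicate_pmf (Suc r * m) p)
     = map_pmf (\<lambda>(xs, ys). xs # chunks r m ys) (map_pmf (\<lambda>xs. (take m xs, drop m xs)) (replicate_pmf (m + r * m) p))"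
  proof -
    have c: "chunks (Suc r) m = (\<lambda>xs. take m xs # chunks r m (drop m xs))" by (rule ext) simp
    show ?thesis by (subst c) (simp add: map_pmf_comp)
  qed
  also have "\<dots> = bind_pmf (replicate_pmf m p) (\<lambda>x. map_pmf (\<lambda>ys. x # ys) (map_pmf (chunks r m) (replicate_pmf (r * m) p)))"
    unfolding replicate_pmf_split
    by (simp add: pair_pmf_def map_pmf_def bind_return_pmf bind_assoc_pmf)
  finally show ?case unfolding Suc.IH by (simp add: map_pmf_def)
qed simp

section \<open>Bayes nets given by positive kernels\<close>

lemma finite_cube [simp]: "finite (cube n)"
  unfolding cube_def by (intro finite_PiE) auto

lemma card_cube: "card (cube n) = 2 ^ n"
  unfolding cube_def by (subst card_PiE) auto

lemma finite_distributions: "P \<in> distributions n \<Longrightarrow> finite (set_pmf P)"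
  unfolding distributions_def using finite_subset[OF _ finite_cube] by auto

lemma sum_PiE_insert_bool:
  fixes g :: "('a \<Rightarrow> bool) \<Rightarrow> real"
  assumes "k \<notin> W" "finite W"
  shows "(\<Sum>x\<in>insert k W \<rightarrow>\<^sub>E UNIV. g x) = (\<Sum>x\<in>W \<rightarrow>\<^sub>E UNIV. g (x(k := True)) + g (x(k := False)))"
proof -
  have "(\<Sum>x\<in>insert k W \<rightarrow>\<^sub>E UNIV. g x) = (\<Sum>(b, x)\<in>UNIV \<times> (W \<rightarrow>\<^sub>E UNIV). g (x(k := b)))"
    unfolding PiE_insert_eq
    using inj_combinator[OF assms(1), of "\<lambda>_. UNIV :: bool set"]
    by (simp add: sum.reindex case_prod_unfold)
  also have "\<dots> = (\<Sum>b\<in>UNIV. \<Sum>x\<in>W \<rightarrow>\<^sub>E UNIV. g (x(k := b)))"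
    by (simp add: sum.cartesian_product)
  also have "\<dots> = (\<Sum>x\<in>W \<rightarrow>\<^sub>E UNIV. g (x(k := True)) + g (x(k := False)))"
    by (simp add: UNIV_bool sum.distrib add.commute)
  finally show ?thesis .
qed

text \<open>A node without a child in \<open>V\<close> can be summed out first; the inductions below
  peel off such nodes one by one.\<close>

lemma finite_acyclic_sink:
  assumes "finite G" "acyclic G" "V \<noteq> {}"
  obtains k where "k \<in> V" "\<And>j. j \<in> V \<Longrightarrow> k \<notin> parents G j"
proof -
  have "wf (G\<inverse>)" using assms(1,2) by (rule finite_acyclic_wf_converse)
  moreover obtain v where "v \<in> V" using assms(3) by blast
  ultimately obtain k where "k \<in> V" "\<And>y. (y, k) \<in> G\<inverse> \<Longrightarrow> y \<notin> V"
    by (rule wfE_min) blast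
  then show ?thesis by (intro that[of k]) (auto simp: parents_def)
qed

text \<open>\<open>f i x\<close> plays the conditional probability of the value \<open>x i\<close>
  given the parents of \<open>i\<close>. Strict positivity gives every parent configuration positive
  probability, so no conditional probability of the net falls back on its default value.\<close>

locale network =
  fixes G :: "(nat \<times> nat) set" and f :: "nat \<Rightarrow> (nat \<Rightarrow> bool) \<Rightarrow> real"
  assumes fin: "finite G" and acyc: "acyclic G"
    and local: "\<And>i x y. (\<And>j. j \<in> insert i (parents G i) \<Longrightarrow> x j = y j) \<Longrightarrow> f i x = f i y"
    and normal: "\<And>i x. f i (x(i := True)) + f i (x(i := False)) = 1"
    and pos: "\<And>i x. 0 < f i x"
begin

lemma self_notin_parents: "i \<notin> parents G i"
  using acyc unfolding acyclic_def parents_def by auto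

text \<open>No factor other than that of \<open>k\<close> sees the coordinate \<open>k\<close>, and
  the two values of that factor add up to 1.\<close>

lemma sum_remove_sink:
  assumes V: "finite V" "k \<in> V" and sink: "\<And>j. j \<in> V \<Longrightarrow> k \<notin> parents G j"
    and \<Phi>: "\<And>x b. \<Phi> (x(k := b)) = \<Phi> x"
  shows "(\<Sum>x\<in>V \<rightarrow>\<^sub>E UNIV. (\<Prod>j\<in>V. f j x) * \<Phi> x) = (\<Sum>x\<in>V - {k} \<rightarrow>\<^sub>E UNIV. (\<Prod>j\<in>V - {k}. f j x) * \<Phi> x)"
proof -
  define W where "W = V - {k}"
  have W: "V = insert k W" "k \<notin> W" "finite W" using V by (auto simp: W_def)
  have indep: "(\<Prod>j\<in>W. f j (x(k := b))) = (\<Prod>j\<in>W. f j x)" for x b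
    using sink W by (intro prod.cong refl local) auto
  have "(\<Sum>x\<in>V \<rightarrow>\<^sub>E UNIV. (\<Prod>j\<in>V. f j x) * \<Phi> x)
      = (\<Sum>x\<in>W \<rightarrow>\<^sub>E UNIV. (f k (x(k := True)) + f k (x(k := False))) * ((\<Prod>j\<in>W. f j x) * \<Phi> x))"
    unfolding W(1) using W(2,3) by (simp add: sum_PiE_insert_bool indep \<Phi> algebra_simps del: fun_upd_apply)
  then show ?thesis unfolding normal W_def by simp
qed

lemma sum_prod_eq_1:
  assumes "finite V"
  shows "(\<Sum>x\<in>V \<rightarrow>\<^sub>E UNIV. \<Prod>j\<in>V. f j x) = 1"
  using assms
proof (induction "card V" arbitrary: V)
  case (Suc c)
  then obtain k where k: "k \<in> V" "\<And>j. j \<in> V \<Longrightarrow> k \<notin> parents G j"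
    using finite_acyclic_sink[OF fin acyc, of V] by (metis card.empty nat.distinct(1))
  have "(\<Sum>x\<in>V - {k} \<rightarrow>\<^sub>E UNIV. \<Prod>j\<in>V - {k}. f j x) = 1"
    using Suc k by (intro Suc.hyps(1)) auto
  with sum_remove_sink[OF Suc.prems k, of "\<lambda>_. 1"] show ?case by simp
qed simp

text \<open>This says in integrated form, against any function \<open>g\<close> of the parent
  values, that \<open>f i\<close> is the conditional law of node \<open>i\<close>. Sinks other than
  \<open>i\<close> are summed out until \<open>i\<close> has no child left; then summing over the
  value of node \<open>i\<close> leaves \<open>f i (x(i := b)) * g x\<close> on both sides.\<close>

lemma sum_conditional:
  assumes "finite V" "i \<in> V"
    and g: "\<And>x y. (\<And>j. j \<in> parents G i \<Longrightarrow> x j = y j) \<Longrightarrow> g x = g y"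
  shows "(\<Sum>x\<in>V \<rightarrow>\<^sub>E UNIV. (\<Prod>j\<in>V. f j x) * (of_bool (x i = b) * g x))
       = (\<Sum>x\<in>V \<rightarrow>\<^sub>E UNIV. (\<Prod>j\<in>V. f j x) * (f i (x(i := b)) * g x))"
  using assms(1,2)
proof (induction "card V" arbitrary: V)
  case (Suc c)
  show ?case
  proof (cases "\<exists>j\<in>V. i \<in> parents G j")
    case False
    define W where "W = V - {i}"
    have W: "V = insert i W" "i \<notin> W" "finite W" using Suc.prems by (auto simp: W_def)
    have indep: "(\<Prod>j\<in>W. f j (x(i := a))) = (\<Prod>j\<in>W. f j x)" for x a
      using False W by (intro prod.cong refl local) auto
    have gi: "g (x(i := a)) = g x" for x a
      using self_notin_parents by (intro g) auto
    have "(\<Sum>x\<in>V \<rightarrow>\<^sub>E UNIV. (\<Prod>j\<in>V. f j x) * (of_bool (x i = b) * g x))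
       = (\<Sum>x\<in>W \<rightarrow>\<^sub>E UNIV. (\<Prod>j\<in>W. f j x) * (f i (x(i := b)) * g x))"
      unfolding W(1) using W(2,3) by (cases b) (simp_all add: sum_PiE_insert_bool indep gi algebra_simps)
    also have "\<dots> = (\<Sum>x\<in>V \<rightarrow>\<^sub>E UNIV. (\<Prod>j\<in>V. f j x) * (f i (x(i := b)) * g x))"
      unfolding W_def using False Suc.prems by (intro sum_remove_sink[symmetric]) (auto simp: gi)
    finally show ?thesis .
  next
    case True
    have "V \<noteq> {}" using Suc.prems by auto
    then obtain k where k: "k \<in> V" "\<And>j. j \<in> V \<Longrightarrow> k \<notin> parents G j"
      using finite_acyclic_sink[OF fin acyc] by blast
    with True have "k \<noteq> i" by auto
    have gk: "g (x(k := a)) = g x" for x a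
      using k Suc.prems by (intro g) auto
    have fk: "f i (x(k := a, i := b)) = f i (x(i := b))" for x a
      using k Suc.prems \<open>k \<noteq> i\<close> by (intro local) auto
    have "(\<Sum>x\<in>V - {k} \<rightarrow>\<^sub>E UNIV. (\<Prod>j\<in>V - {k}. f j x) * (of_bool (x i = b) * g x))
       = (\<Sum>x\<in>V - {k} \<rightarrow>\<^sub>E UNIV. (\<Prod>j\<in>V - {k}. f j x) * (f i (x(i := b)) * g x))"
      using Suc k \<open>k \<noteq> i\<close> by (intro Suc.hyps(1)) auto
    moreover have "(\<Sum>x\<in>V \<rightarrow>\<^sub>E UNIV. (\<Prod>j\<in>V. f j x) * (of_bool (x i = b) * g x))
      = (\<Sum>x\<in>V - {k} \<rightarrow>\<^sub>E UNIV. (\<Prod>j\<in>V - {k}. f j x) * (of_bool (x i = b) * g x))"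
      using Suc.prems k \<open>k \<noteq> i\<close> by (intro sum_remove_sink) (auto simp: gk)
    moreover have "(\<Sum>x\<in>V \<rightarrow>\<^sub>E UNIV. (\<Prod>j\<in>V. f j x) * (f i (x(i := b)) * g x))
      = (\<Sum>x\<in>V - {k} \<rightarrow>\<^sub>E UNIV. (\<Prod>j\<in>V - {k}. f j x) * (f i (x(i := b)) * g x))"
      using Suc.prems k \<open>k \<noteq> i\<close> by (intro sum_remove_sink) (auto simp: gk fk)
    ultimately show ?thesis by simp
  qed
qed simp

definition net :: "nat \<Rightarrow> (nat \<Rightarrow> bool) pmf" where
  "net n = embed_pmf (\<lambda>x. if x \<in> cube n then \<Prod>i\<in>{1..n}. f i x else 0)"

lemma pmf_net: "pmf (net n) x = (if x \<in> cube n then \<Prod>i\<in>{1..n}. f i x else 0)"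
  unfolding net_def
proof (rule pmf_embed_pmf)
  let ?h = "\<lambda>x. if x \<in> cube n then \<Prod>i\<in>{1..n}. f i x else 0"
  show nonneg: "0 \<le> ?h x" for x
    by (auto intro!: prod_nonneg less_imp_le[OF pos])
  have "(\<integral>\<^sup>+x. ennreal (?h x) \<partial>count_space UNIV) = (\<integral>\<^sup>+x. ennreal (?h x) \<partial>count_space (cube n))"
    by (subst nn_integral_count_space_indicator) (auto intro!: nn_integral_cong split: split_indicator)
  also have "\<dots> = (\<Sum>x\<in>cube n. ennreal (?h x))"
    by (rule nn_integral_count_space_finite) simp
  also have "\<dots> = ennreal (\<Sum>x\<in>cube n. ?h x)"
    by (rule sum_ennreal) (rule nonneg)
  also have "(\<Sum>x\<in>cube n. ?h x) = 1"
    using sum_prod_eq_1[of "{1..n}"] by (simp add: cube_def)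
  finally show "(\<integral>\<^sup>+x. ennreal (?h x) \<partial>count_space UNIV) = 1" by simp
qed

lemma net_in_distributions: "net n \<in> distributions n"
  unfolding distributions_def by (auto simp: set_pmf_eq pmf_net split: if_splits)

lemma prob_net: "measure_pmf.prob (net n) {y. R y} = (\<Sum>x\<in>{1..n} \<rightarrow>\<^sub>E UNIV. (\<Prod>i\<in>{1..n}. f i x) * of_bool (R x))"
proof -
  have "measure_pmf.prob (net n) {y. R y} = (\<Sum>x\<in>cube n. pmf (net n) x * of_bool (R x))"
    unfolding prob_conv_E using net_in_distributions[of n]
    by (intro E_conv_sum) (auto simp: distributions_def)
  then show ?thesis by (simp add: pmf_net cube_def)
qed

lemma markov_net: "markov n G (net n)"
  unfolding markov_def
proof
  fix x assume x: "x \<in> cube n"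
  have "\<P>(y in net n. y i = x i \<bar> restrict y (parents G i) = restrict x (parents G i)) = f i x"
    if i: "i \<in> {1..n}" for i
  proof -
    let ?R = "\<lambda>y. restrict y (parents G i) = restrict x (parents G i)"
    have R: "?R y \<longleftrightarrow> (\<forall>j\<in>parents G i. y j = x j)" for y
      by (auto simp: restrict_def fun_eq_iff)
    have "measure_pmf.prob (net n) {y. y i = x i \<and> ?R y}
       = (\<Sum>y\<in>{1..n} \<rightarrow>\<^sub>E UNIV. (\<Prod>j\<in>{1..n}. f j y) * (of_bool (y i = x i) * of_bool (?R y)))"
      by (simp add: prob_net of_bool_conj)
    also have "\<dots> = (\<Sum>y\<in>{1..n} \<rightarrow>\<^sub>E UNIV. (\<Prod>j\<in>{1..n}. f j y) * (f i (y(i := x i)) * of_bool (?R y)))"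
      using i by (intro sum_conditional) (auto simp: R)
    also have "\<dots> = (\<Sum>y\<in>{1..n} \<rightarrow>\<^sub>E UNIV. (\<Prod>j\<in>{1..n}. f j y) * (f i x * of_bool (?R y)))"
    proof (rule sum.cong[OF refl])
      fix y
      have "f i (y(i := x i)) = f i x" if "?R y"
        using that by (intro local) (auto simp: R)
      then show "(\<Prod>j\<in>{1..n}. f j y) * (f i (y(i := x i)) * of_bool (?R y)) = (\<Prod>j\<in>{1..n}. f j y) * (f i x * of_bool (?R y))"
        by auto
    qed
    also have "\<dots> = f i x * measure_pmf.prob (net n) {y. ?R y}"
      by (simp add: prob_net sum_distrib_left mult_ac)
    finally have *: "measure_pmf.prob (net n) {y. y i = x i \<and> ?R y} = f i x * measure_pmf.prob (net n) {y. ?R y}" .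
    \<comment> \<open>Positivity allows division by the probability of the parent
      configuration.\<close>
    have "0 < pmf (net n) x"
      using x by (auto simp: pmf_net intro!: prod_pos pos)
    also have "\<dots> \<le> measure_pmf.prob (net n) {y. ?R y}"
      unfolding measure_pmf_single[symmetric] by (intro measure_pmf.finite_measure_mono) auto
    finally show ?thesis using * by (simp add: cond_prob_def)
  qed
  then show "pmf (net n) x = (\<Prod>i\<in>{1..n}. \<P>(y in net n. y i = x i \<bar> restrict y (parents G i) = restrict x (parents G i)))"
    using x by (simp add: pmf_net)
qed

end

section \<open>The distance to a graph\<close>

lemma hellinger_nonneg: "0 \<le> hellinger n P Q"
  unfolding hellinger_def by (simp add: sum_nonneg)

lemma hellinger_graph_le:
  assumes "Q \<in> distributions n" "markov n G Q"
  shows "hellinger_graph n P G \<le> hellinger n P Q"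
  unfolding hellinger_graph_def
  using assms hellinger_nonneg by (intro cINF_lower bdd_belowI2[of _ 0]) auto

text \<open>Independent fair coins are an example; the infimum defining the distance is thus over a
  nonempty set.\<close>

lemma ex_markov:
  assumes "finite G" "acyclic G"
  shows "\<exists>Q. Q \<in> distributions n \<and> markov n G Q"
proof -
  interpret network G "\<lambda>_ _. 1 / 2" by standard (use assms in auto)
  show ?thesis using net_in_distributions markov_net by blast
qed

lemma cond_prob_prod_null:
  fixes Q :: "(nat \<Rightarrow> bool) pmf"
  assumes "i \<in> I" "finite I" "measure_pmf.prob Q {y. restrict y (pa i) = restrict x (pa i)} = 0"
  shows "(\<Prod>i\<in>I. \<P>(y in Q. y i = x i \<bar> restrict y (pa i) = restrict x (pa i))) = 0"
proof -
  \<comment> \<open>The quotient has denominator 0 and is therefore 0.\<close>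
  have "\<P>(y in Q. y i = x i \<bar> restrict y (pa i) = restrict x (pa i)) = 0"
    using assms(3) by (simp add: cond_prob_def)
  then show ?thesis using assms(1,2) by (intro prod_zero) auto
qed

text \<open>The infimum defining the distance to a graph is attained: factorisation is a closed
  condition, because where a parent configuration has probability 0 in the limit, both sides vanish.\<close>
lemma hellinger_graph_eq_0_imp_markov:
  assumes G: "finite G" "acyclic G" and P: "P \<in> distributions n" and 0: "hellinger_graph n P G = 0"
  shows "markov n G P"
proof -
  let ?M = "{Q \<in> distributions n. markov n G Q}"
  have ne: "?M \<noteq> {}" using ex_markov[OF G] by blast
  have "\<exists>Q\<in>?M. hellinger n P Q < 1 / real (Suc k)" for k
  proof (rule ccontr)
    assume "\<not> ?thesis"
    then have "1 / real (Suc k) \<le> hellinger_graph n P G"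
      unfolding hellinger_graph_def using ne by (intro cINF_greatest) auto
    with 0 show False by simp
  qed
  then obtain Q where Q: "\<And>k. Q k \<in> ?M" "\<And>k. hellinger n P (Q k) < 1 / real (Suc k)"
    by metis
  have "(\<lambda>k. hellinger n P (Q k)) \<longlonglongrightarrow> 0"
  proof (rule tendsto_sandwich[of "\<lambda>_. 0" _ _ "\<lambda>k. 1 / real (Suc k)"])
    show "(\<lambda>k. 1 / real (Suc k)) \<longlonglongrightarrow> 0"
      using LIMSEQ_inverse_real_of_nat by (simp add: inverse_eq_divide)
  qed (use Q(2) hellinger_nonneg in \<open>auto intro!: always_eventually less_imp_le simp del: of_nat_Suc\<close>)
  then have lim0: "(\<lambda>k. 2 * (hellinger n P (Q k))\<^sup>2) \<longlonglongrightarrow> 0"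
    by (auto intro!: tendsto_eq_intros)
  \<comment> \<open>Each squared difference of roots is one summand of twice the squared distance,
    so Hellinger convergence forces pointwise convergence.\<close>
  have lim: "(\<lambda>k. pmf (Q k) x) \<longlonglongrightarrow> pmf P x" if x: "x \<in> cube n" for x
  proof -
    have "(\<lambda>k. (sqrt (pmf P x) - sqrt (pmf (Q k) x))\<^sup>2) \<longlonglongrightarrow> 0"
    proof (rule tendsto_sandwich[OF _ _ tendsto_const lim0])
      show "\<forall>\<^sub>F k in sequentially. (sqrt (pmf P x) - sqrt (pmf (Q k) x))\<^sup>2 \<le> 2 * (hellinger n P (Q k))\<^sup>2"
        unfolding hellinger_def
        by (intro always_eventually allI, subst real_sqrt_pow2)
          (auto intro!: sum_nonneg member_le_sum[OF x, of "\<lambda>x. (sqrt (pmf P x) - sqrt (pmf (Q _) x))\<^sup>2"])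
    qed auto
    then have "(\<lambda>k. sqrt ((sqrt (pmf P x) - sqrt (pmf (Q k) x))\<^sup>2)) \<longlonglongrightarrow> sqrt 0"
      by (rule tendsto_real_sqrt)
    then have "(\<lambda>k. sqrt (pmf P x) - sqrt (pmf (Q k) x)) \<longlonglongrightarrow> 0"
      by (simp add: tendsto_rabs_zero_iff)
    then have "(\<lambda>k. sqrt (pmf P x) - (sqrt (pmf P x) - sqrt (pmf (Q k) x))) \<longlonglongrightarrow> sqrt (pmf P x) - 0"
      by (intro tendsto_diff tendsto_const)
    then have "(\<lambda>k. (sqrt (pmf (Q k) x))\<^sup>2) \<longlonglongrightarrow> (sqrt (pmf P x))\<^sup>2"
      by (intro tendsto_power) simp
    then show ?thesis by simp
  qed
  have prob_sum: "measure_pmf.prob R {y. S y} = (\<Sum>y\<in>cube n. pmf R y * of_bool (S y))"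
    if "R \<in> distributions n" for R S
    unfolding prob_conv_E using that by (intro E_conv_sum) (auto simp: distributions_def)
  have limS: "(\<lambda>k. measure_pmf.prob (Q k) {y. S y}) \<longlonglongrightarrow> measure_pmf.prob P {y. S y}" for S
  proof -
    have "(\<lambda>k. \<Sum>y\<in>cube n. pmf (Q k) y * of_bool (S y)) \<longlonglongrightarrow> (\<Sum>y\<in>cube n. pmf P y * of_bool (S y))"
      by (intro tendsto_sum tendsto_mult tendsto_const lim)
    then show ?thesis using Q(1) P by (simp add: prob_sum)
  qed
  show ?thesis unfolding markov_def
  proof
    fix x assume x: "x \<in> cube n"
    let ?c = "\<lambda>R i. \<P>(y in measure_pmf R. y i = x i \<bar> restrict y (parents G i) = restrict x (parents G i))"
    show "pmf P x = (\<Prod>i\<in>{1..n}. ?c P i)"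
    proof (cases "\<exists>i\<in>{1..n}. measure_pmf.prob P {y. restrict y (parents G i) = restrict x (parents G i)} = 0")
      case True
      then obtain i where i: "i \<in> {1..n}" "measure_pmf.prob P {y. restrict y (parents G i) = restrict x (parents G i)} = 0"
        by blast
      have "pmf P x \<le> measure_pmf.prob P {y. restrict y (parents G i) = restrict x (parents G i)}"
        unfolding measure_pmf_single[symmetric] by (intro measure_pmf.finite_measure_mono) auto
      then have "pmf P x = 0" using i(2) by (simp add: antisym)
      with cond_prob_prod_null[of i "{1..n}" P "parents G" x] i show ?thesis by simp
    next
      case False
      \<comment> \<open>No denominator vanishes in the limit, so the quotients converge.\<close>
      have "(\<lambda>k. \<Prod>i\<in>{1..n}. ?c (Q k) i) \<longlonglongrightarrow> (\<Prod>i\<in>{1..n}. ?c P i)"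
        unfolding cond_prob_def using False by (intro tendsto_prod tendsto_divide) (auto intro: limS)
      moreover have "(\<Prod>i\<in>{1..n}. ?c (Q k) i) = pmf (Q k) x" for k
        using Q(1)[of k] x by (simp add: markov_def)
      ultimately show ?thesis using lim[OF x] LIMSEQ_unique by simp
    qed
  qed
qed

section \<open>Learning a net by smoothed empirical conditionals\<close>

definition agree :: "(nat \<times> nat) set \<Rightarrow> nat \<Rightarrow> (nat \<Rightarrow> bool) \<Rightarrow> (nat \<Rightarrow> bool) \<Rightarrow> bool" where
  "agree G i x y \<longleftrightarrow> restrict y (parents G i) = restrict x (parents G i)"

lemma agree_iff: "agree G i x y \<longleftrightarrow> (\<forall>j\<in>parents G i. y j = x j)"
  unfolding agree_def by (auto simp: restrict_def fun_eq_iff)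

text \<open>One fictitious sample for each value of \<open>y i\<close> keeps the estimate positive
  on unseen configurations and makes the two estimates add up to 1.\<close>

definition smoothed :: "(nat \<times> nat) set \<Rightarrow> (nat \<Rightarrow> bool) list \<Rightarrow> nat \<Rightarrow> (nat \<Rightarrow> bool) \<Rightarrow> real" where
  "smoothed G ys i x = (real (hits (\<lambda>y. y i = x i \<and> agree G i x y) ys) + 1) / (real (hits (agree G i x) ys) + 2)"

text \<open>Node \<open>i\<close> is fitted on a batch of its own, so that the factors of the learned net are independent.\<close>
definition learned_factor :: "(nat \<times> nat) set \<Rightarrow> (nat \<Rightarrow> bool) list list \<Rightarrow> nat \<Rightarrow> (nat \<Rightarrow> bool) \<Rightarrow> real" where
  "learned_factor G yss i x = smoothed G (yss ! (i - 1)) i x"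

definition learned :: "nat \<Rightarrow> (nat \<times> nat) set \<Rightarrow> (nat \<Rightarrow> bool) list list \<Rightarrow> (nat \<Rightarrow> bool) pmf" where
  "learned n G yss = network.net (learned_factor G yss) n"

text \<open>The threshold \<open>n\<close> bounds the expected excess of each of the
  \<open>n\<close> factors by \<open>1 / n\<close>, so their sum is at most 1, as
  \<open>prod_one_plus_le\<close> demands. Nodes are numbered from 1 and batches from 0, hence
  \<open>i - 1\<close>.\<close>

definition heavy :: "nat \<Rightarrow> (nat \<times> nat) set \<Rightarrow> (nat \<Rightarrow> bool) list list \<Rightarrow> (nat \<Rightarrow> bool) set" where
  "heavy n G yss = {x \<in> cube n. \<forall>i\<in>{1..n}. n \<le> hits (agree G i x) (yss ! (i - 1))}"

text \<open>Chi-square distance where the learned net is reliable; elsewhere the inverse of the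
  learned probability is not controlled, and the two masses are counted instead.\<close>

definition discrepancy :: "nat \<Rightarrow> (nat \<Rightarrow> bool) set \<Rightarrow> (nat \<Rightarrow> bool) pmf \<Rightarrow> (nat \<Rightarrow> bool) pmf \<Rightarrow> real" where
  "discrepancy n A P Q = (\<Sum>x\<in>cube n. of_bool (x \<in> A) * ((pmf P x - pmf Q x)\<^sup>2 / pmf Q x)
     + of_bool (x \<notin> A) * (pmf P x + pmf Q x))"

lemma network_learned:
  assumes "finite G" "acyclic G"
  shows "network G (learned_factor G yss)"
proof
  fix i x
  have i: "i \<notin> parents G i"
    using assms(2) unfolding acyclic_def parents_def by auto
  have ag: "agree G i (x(i := b)) = agree G i x" for b
    using i by (auto simp: agree_iff fun_eq_iff)
  \<comment> \<open>Samples with the given parent configuration divide by the value of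
    \<open>y i\<close>, so the two numerators add up to the common denominator.\<close>
  have split: "hits (\<lambda>y. y i \<and> agree G i x y) ys + hits (\<lambda>y. \<not> y i \<and> agree G i x y) ys = hits (agree G i x) ys" for ys
    by (induction ys) auto
  have "real (hits (agree G i x) ys) = real (hits (\<lambda>y. y i \<and> agree G i x y) ys) + real (hits (\<lambda>y. \<not> y i \<and> agree G i x y) ys)" for ys
    by (simp flip: split)
  then show "learned_factor G yss i (x(i := True)) + learned_factor G yss i (x(i := False)) = 1"
    unfolding learned_factor_def smoothed_def ag by (simp add: add_divide_distrib[symmetric])
  show "0 < learned_factor G yss i x"
    unfolding learned_factor_def smoothed_def by (intro divide_pos_pos) auto
next
  fix i x y assume *: "\<And>j. j \<in> insert i (parents G i) \<Longrightarrow> (x j :: bool) = y j"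
  have "agree G i x = agree G i y" "x i = y i" using * by (auto simp: agree_iff fun_eq_iff)
  then show "learned_factor G yss i x = learned_factor G yss i y"
    unfolding learned_factor_def smoothed_def by simp
qed (use assms in auto)

lemma prod_one_plus_le:
  fixes a :: "nat \<Rightarrow> real"
  assumes "finite I" "\<And>i. i \<in> I \<Longrightarrow> 0 \<le> a i" "(\<Sum>i\<in>I. a i) \<le> 1"
  shows "(\<Prod>i\<in>I. 1 + a i) \<le> 1 + 2 * (\<Sum>i\<in>I. a i)"
proof -
  let ?s = "\<Sum>i\<in>I. a i"
  have s: "0 \<le> ?s" using assms by (intro sum_nonneg)
  have "(\<Prod>i\<in>I. 1 + a i) \<le> (\<Prod>i\<in>I. exp (a i))"
    using assms by (intro prod_mono) (auto simp: add_nonneg_nonneg)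
  also have "\<dots> = exp ?s" using assms(1) by (simp add: exp_sum)
  also have "\<dots> \<le> 1 + ?s + ?s\<^sup>2" using s assms(3) by (rule exp_bound)
  also have "?s\<^sup>2 \<le> ?s" using s assms(3) by (simp add: power2_eq_square mult_left_le)
  finally show ?thesis by simp
qed

section \<open>Expected error of the learned net\<close>

locale learning =
  fixes n d :: nat and G :: "(nat \<times> nat) set" and P :: "(nat \<Rightarrow> bool) pmf" and k :: nat
  assumes n: "n \<ge> 1" and G: "G \<in> dags n d" and P: "P \<in> distributions n" and mk: "markov n G P"
begin

text \<open>Mean inverse counts measure the error throughout: they bound both the excess of the
  ratio of \<open>P\<close> to the learned net and the chance that a point is light.\<close>

abbreviation "U x i \<equiv> E (replicate_pmf k P) (\<lambda>ys. 1 / (real (hits (agree G i x) ys) + 1))"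
abbreviation "w i x \<equiv> measure_pmf.prob P {y. agree G i x y}"

lemma finP: "finite (set_pmf P)"
  using P by (rule finite_distributions)

lemma pmf_le_w: "pmf P x \<le> w i x"
  unfolding measure_pmf_single[symmetric]
  by (intro measure_pmf.finite_measure_mono) (auto simp: agree_def)

lemma U_nonneg: "0 \<le> U x i"
  by (intro E_nonneg) auto

text \<open>Points are grouped by their parent configuration at \<open>i\<close>: within a group the
  quotients add up to 1, or to 0 if it is null, and there are at most \<open>2 ^ d\<close>
  groups.\<close>

lemma sum_pmf_div_le:
  assumes i: "i \<in> {1..n}"
  shows "(\<Sum>x\<in>cube n. pmf P x / w i x) \<le> 2 ^ d"
proof -
  let ?r = "\<lambda>x. restrict x (parents G i)"
  have fp: "finite (parents G i)"
    using G finite_subset[of "parents G i" "{1..n}"] by (auto simp: dags_def parents_def)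
  have inner: "(\<Sum>x\<in>{x \<in> cube n. ?r x = c}. pmf P x / w i x) \<le> 1" for c
  proof -
    have w: "w i x = (\<Sum>y\<in>{y \<in> cube n. ?r y = c}. pmf P y)" if "?r x = c" for x
    proof -
      have "w i x = (\<Sum>y\<in>cube n. pmf P y * of_bool (?r y = c))"
        unfolding prob_conv_E agree_def that using P by (intro E_conv_sum) (auto simp: distributions_def)
      also have "\<dots> = (\<Sum>y\<in>{y \<in> cube n. ?r y = c}. pmf P y)"
        by (intro sum.mono_neutral_cong_right) auto
      finally show ?thesis .
    qed
    have "(\<Sum>x\<in>{x \<in> cube n. ?r x = c}. pmf P x / w i x)
        = (\<Sum>x\<in>{x \<in> cube n. ?r x = c}. pmf P x / (\<Sum>y\<in>{y \<in> cube n. ?r y = c}. pmf P y))"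
      by (intro sum.cong refl) (use w in auto)
    also have "\<dots> \<le> 1"
      by (simp add: sum_divide_distrib[symmetric] divide_le_eq_1)
    finally show ?thesis .
  qed
  have "(\<Sum>x\<in>cube n. pmf P x / w i x) = (\<Sum>c\<in>?r ` cube n. \<Sum>x\<in>{x \<in> cube n. ?r x = c}. pmf P x / w i x)"
    by (rule sum.image_gen) simp
  also have "\<dots> \<le> (\<Sum>c\<in>?r ` cube n. 1)" by (intro sum_mono inner)
  also have "\<dots> = real (card (?r ` cube n))" by simp
  also have "card (?r ` cube n) \<le> card (parents G i \<rightarrow>\<^sub>E (UNIV :: bool set))"
    using fp by (intro card_mono finite_PiE) auto
  also have "card (parents G i \<rightarrow>\<^sub>E (UNIV :: bool set)) = 2 ^ card (parents G i)"
    using fp by (subst card_PiE) auto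
  also have "real (2 ^ card (parents G i)) \<le> 2 ^ d"
    using G i by (auto simp: dags_def intro!: power_increasing)
  finally show ?thesis by simp
qed

lemma sum_U_le:
  assumes i: "i \<in> {1..n}"
  shows "real (Suc k) * (\<Sum>x\<in>cube n. pmf P x * U x i) \<le> 2 ^ d"
proof -
  have "real (Suc k) * (pmf P x * U x i) \<le> pmf P x / w i x" for x
  proof (cases "pmf P x = 0")
    case False
    then have "0 < pmf P x" by (simp add: order_less_le)
    with pmf_le_w[of x i] have w: "0 < w i x" by simp
    have "real (Suc k) * w i x * U x i \<le> 1"
      using E_inverse_hits_le[OF finP, of k "agree G i x"] .
    then have "real (Suc k) * U x i \<le> 1 / w i x"
      using w by (simp add: le_divide_eq mult_ac)
    then have "pmf P x * (real (Suc k) * U x i) \<le> pmf P x * (1 / w i x)"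
      by (intro mult_left_mono) auto
    then show ?thesis by (simp add: mult_ac)
  qed simp
  then have "real (Suc k) * (\<Sum>x\<in>cube n. pmf P x * U x i) \<le> (\<Sum>x\<in>cube n. pmf P x / w i x)"
    unfolding sum_distrib_left by (intro sum_mono)
  with sum_pmf_div_le[OF i] show ?thesis by simp
qed

text \<open>Separate batches make the ratio a product of independent factors. By
  \<open>E_smoothed_ratio_le\<close>, factor \<open>i\<close> has mean at most
  \<open>1 + a i\<close>, the excess coming from \<open>(j + 2) / (j + 1) = 1 + 1 / (j + 1)\<close>
  for a count \<open>j\<close> of at least \<open>n\<close>.\<close>

lemma E_ratio_le:
  assumes x: "x \<in> cube n" and px: "0 < pmf P x"
  shows "E (replicate_pmf n (replicate_pmf k P)) (\<lambda>yss. of_bool (x \<in> heavy n G yss) * (pmf P x / pmf (learned n G yss) x))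
       \<le> 1 + 2 * (\<Sum>i\<in>{1..n}. U x i)"
proof -
  \<comment> \<open>The denominator of the smoothed estimate, cut off at light counts.\<close>
  define h where "h = (\<lambda>j. of_bool (n \<le> j) * (real j + 2))"
  define g where "g = (\<lambda>i ys. measure_pmf.prob P {y. y i = x i \<and> agree G i x y} / w i x
      * h (hits (agree G i x) ys) / (real (hits (\<lambda>y. y i = x i \<and> agree G i x y) ys) + 1))"
  define a where "a = (\<lambda>i. E (replicate_pmf k P) (\<lambda>ys. of_bool (n \<le> hits (agree G i x) ys) / (real (hits (agree G i x) ys) + 1)))"
  note fk = finite_set_replicate_pmf[OF finP]
  have fac: "of_bool (x \<in> heavy n G yss) * (pmf P x / pmf (learned n G yss) x) = (\<Prod>i<n. g (Suc i) (yss ! i))" for yss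
  proof -
    interpret network G "learned_factor G yss"
      using G by (intro network_learned) (auto simp: dags_def intro: finite_subset)
    have "pmf P x = (\<Prod>i\<in>{1..n}. measure_pmf.prob P {y. y i = x i \<and> agree G i x y} / w i x)"
      using mk x by (simp add: markov_def cond_prob_def agree_def)
    moreover have "of_bool (x \<in> heavy n G yss) = (\<Prod>i\<in>{1..n}. of_bool (n \<le> hits (agree G i x) (yss ! (i - 1))) :: real)"
    proof (cases "x \<in> heavy n G yss")
      case False
      then obtain i where "i \<in> {1..n}" "\<not> n \<le> hits (agree G i x) (yss ! (i - 1))"
        using x by (auto simp: heavy_def)
      then have "(\<Prod>i\<in>{1..n}. of_bool (n \<le> hits (agree G i x) (yss ! (i - 1))) :: real) = 0"
        by (intro prod_zero) auto
      with False show ?thesis by simp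
    qed (auto simp: heavy_def)
    ultimately have "of_bool (x \<in> heavy n G yss) * (pmf P x / pmf (learned n G yss) x)
       = (\<Prod>i\<in>{1..n}. of_bool (n \<le> hits (agree G i x) (yss ! (i - 1)))
            * (measure_pmf.prob P {y. y i = x i \<and> agree G i x y} / w i x / learned_factor G yss i x))"
      using x by (simp add: learned_def pmf_net prod_dividef prod.distrib)
    also have "\<dots> = (\<Prod>i\<in>{1..n}. g i (yss ! (i - 1)))"
      by (intro prod.cong refl) (simp add: g_def h_def learned_factor_def smoothed_def)
    also have "\<dots> = (\<Prod>i<n. g (Suc i) (yss ! i))"
      by (simp add: prod.atLeast1_atMost_eq)
    finally show ?thesis .
  qed
  have a: "0 \<le> a i" "a i \<le> U x i" "a i \<le> 1 / real n" for i
  proof -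
    show "0 \<le> a i" unfolding a_def by (intro E_nonneg) auto
    show "a i \<le> U x i" unfolding a_def by (intro E_mono fk) (auto simp: divide_simps)
    have "a i \<le> E (replicate_pmf k P) (\<lambda>_. 1 / real n)"
      unfolding a_def using n by (intro E_mono fk) (auto simp: divide_simps)
    then show "a i \<le> 1 / real n" by simp
  qed
  have Eg: "E (replicate_pmf k P) (g i) \<le> 1 + a i" for i
  proof -
    have w: "0 < w i x" using px pmf_le_w[of x i] by simp
    have "E (replicate_pmf k P) (g i) \<le> E (replicate_pmf k P) (\<lambda>ys. h (hits (agree G i x) ys) / (real (hits (agree G i x) ys) + 1))"
      unfolding g_def using w by (intro E_smoothed_ratio_le finP) (auto simp: h_def)
    also have "\<dots> \<le> E (replicate_pmf k P) (\<lambda>ys. 1 + of_bool (n \<le> hits (agree G i x) ys) / (real (hits (agree G i x) ys) + 1))"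
      by (intro E_mono fk) (auto simp: h_def field_simps)
    also have "\<dots> = 1 + a i" by (simp add: E_add[OF fk] a_def)
    finally show ?thesis .
  qed
  have "E (replicate_pmf n (replicate_pmf k P)) (\<lambda>yss. of_bool (x \<in> heavy n G yss) * (pmf P x / pmf (learned n G yss) x))
      = (\<Prod>i<n. E (replicate_pmf k P) (g (Suc i)))"
    unfolding fac by (rule E_prod_replicate[OF fk])
  also have "\<dots> = (\<Prod>i\<in>{1..n}. E (replicate_pmf k P) (g i))"
    by (simp add: prod.atLeast1_atMost_eq)
  also have "\<dots> \<le> (\<Prod>i\<in>{1..n}. 1 + a i)"
    by (intro prod_mono conjI Eg E_nonneg) (auto simp: g_def h_def)
  also have "\<dots> \<le> 1 + 2 * (\<Sum>i\<in>{1..n}. a i)"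
  proof (rule prod_one_plus_le)
    have "(\<Sum>i\<in>{1..n}. a i) \<le> (\<Sum>i\<in>{1..n}. 1 / real n)" by (intro sum_mono a)
    then show "(\<Sum>i\<in>{1..n}. a i) \<le> 1" using n by simp
  qed (auto simp: a)
  also have "\<dots> \<le> 1 + 2 * (\<Sum>i\<in>{1..n}. U x i)" by (simp add: sum_mono a)
  finally show ?thesis .
qed

text \<open>A light point has a node whose count is below \<open>n\<close>, and there
  \<open>n / (count + 1)\<close> is at least 1; sum over the nodes.\<close>

lemma E_light_le:
  assumes x: "x \<in> cube n"
  shows "E (replicate_pmf n (replicate_pmf k P)) (\<lambda>yss. of_bool (x \<notin> heavy n G yss)) \<le> real n * (\<Sum>i\<in>{1..n}. U x i)"
proof -
  note fk = finite_set_replicate_pmf[OF finP]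
  note fkn = finite_set_replicate_pmf[OF fk]
  let ?t = "\<lambda>i ys. real n / (real (hits (agree G i x) ys) + 1)"
  have "E (replicate_pmf n (replicate_pmf k P)) (\<lambda>yss. of_bool (x \<notin> heavy n G yss))
      \<le> E (replicate_pmf n (replicate_pmf k P)) (\<lambda>yss. \<Sum>i\<in>{1..n}. ?t i (yss ! (i - 1)))"
  proof (rule E_mono[OF fkn])
    fix yss
    show "of_bool (x \<notin> heavy n G yss) \<le> (\<Sum>i\<in>{1..n}. ?t i (yss ! (i - 1)))"
    proof (cases "x \<in> heavy n G yss")
      case False
      then obtain i where i: "i \<in> {1..n}" "hits (agree G i x) (yss ! (i - 1)) < n"
        using x by (auto simp: heavy_def)
      then have "1 \<le> ?t i (yss ! (i - 1))" by (simp add: le_divide_eq)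
      also have "\<dots> \<le> (\<Sum>i\<in>{1..n}. ?t i (yss ! (i - 1)))"
        using i(1) by (rule member_le_sum) auto
      finally show ?thesis using False by simp
    qed (auto intro!: sum_nonneg)
  qed
  also have "\<dots> = (\<Sum>i\<in>{1..n}. E (replicate_pmf k P) (?t i))"
    unfolding E_sum[OF fkn] by (intro sum.cong refl E_nth_replicate fk) auto
  also have "\<dots> = (\<Sum>i\<in>{1..n}. real n * U x i)"
    by (intro sum.cong refl) (simp flip: integral_mult_right_zero)
  finally show ?thesis by (simp add: sum_distrib_left)
qed

lemma E_discrepancy_le:
  "real (Suc k) * E (replicate_pmf n (replicate_pmf k P)) (\<lambda>yss. discrepancy n (heavy n G yss) P (learned n G yss))
     \<le> 5 * real n ^ 2 * 2 ^ d"
proof -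
  note fkn = finite_set_replicate_pmf[OF finite_set_replicate_pmf[OF finP]]
  let ?E = "E (replicate_pmf n (replicate_pmf k P))"
  let ?r = "\<lambda>x yss. of_bool (x \<in> heavy n G yss) * (pmf P x / pmf (learned n G yss) x)"
  let ?l = "\<lambda>x yss. of_bool (x \<notin> heavy n G yss) :: real"
  have sumP: "(\<Sum>x\<in>cube n. pmf P x) = 1"
    using P by (intro sum_pmf_eq_1) (auto simp: distributions_def)
  \<comment> \<open>With \<open>Q\<close> the learned net, each chi-square term on the heavy set
    expands to \<open>P^2 / Q - 2 P + Q\<close>; off it, \<open>P + Q = 3 P - 2 P + Q\<close>. The
    common part \<open>- 2 P + Q\<close> sums to -1.\<close>
  have D: "discrepancy n (heavy n G yss) P (learned n G yss)
      = (\<Sum>x\<in>cube n. pmf P x * ?r x yss + 3 * pmf P x * ?l x yss) - 1" for yss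
  proof -
    interpret network G "learned_factor G yss"
      using G by (intro network_learned) (auto simp: dags_def intro: finite_subset)
    let ?Q = "learned n G yss"
    have sumQ: "(\<Sum>x\<in>cube n. pmf ?Q x) = 1"
      using net_in_distributions[of n] unfolding learned_def
      by (intro sum_pmf_eq_1) (auto simp: distributions_def)
    have "0 < pmf ?Q x" if "x \<in> cube n" for x
      using that by (auto simp: learned_def pmf_net intro!: prod_pos pos)
    then have "discrepancy n (heavy n G yss) P ?Q
      = (\<Sum>x\<in>cube n. (pmf P x * ?r x yss + 3 * pmf P x * ?l x yss) - 2 * pmf P x + pmf ?Q x)"
      unfolding discrepancy_def
      by (intro sum.cong refl) (force simp: field_simps power2_eq_square)
    then show ?thesis
      by (simp add: sum.distrib sum_subtractf sum_distrib_left[symmetric] sumP sumQ)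
  qed
  have "?E (\<lambda>yss. discrepancy n (heavy n G yss) P (learned n G yss))
      = (\<Sum>x\<in>cube n. pmf P x * ?E (?r x) + 3 * pmf P x * ?E (?l x)) - 1"
    unfolding D by (simp only: E_diff[OF fkn] E_sum[OF fkn] E_add[OF fkn] integral_mult_right_zero) simp
  also have "\<dots> \<le> (\<Sum>x\<in>cube n. pmf P x * (1 + 5 * real n * (\<Sum>i\<in>{1..n}. U x i))) - 1"
  proof (intro diff_right_mono sum_mono)
    fix x assume x: "x \<in> cube n"
    let ?S = "\<Sum>i\<in>{1..n}. U x i"
    show "pmf P x * ?E (?r x) + 3 * pmf P x * ?E (?l x) \<le> pmf P x * (1 + 5 * real n * ?S)"
    proof (cases "pmf P x = 0")
      case False
      then have px: "0 < pmf P x" by (simp add: order_less_le)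
      have S: "0 \<le> ?S" by (intro sum_nonneg U_nonneg)
      have "?E (?r x) + 3 * ?E (?l x) \<le> 1 + 2 * ?S + 3 * (real n * ?S)"
        using E_ratio_le[OF x px] E_light_le[OF x] by simp
      \<comment> \<open>As \<open>n\<close> is at least 1, \<open>2 + 3 n\<close> is at most
        \<open>5 n\<close>.\<close>
      also have "\<dots> \<le> 1 + 5 * real n * ?S"
        using mult_right_mono[OF _ S, of 1 "real n"] n by simp
      finally have "pmf P x * (?E (?r x) + 3 * ?E (?l x)) \<le> pmf P x * (1 + 5 * real n * ?S)"
        by (intro mult_left_mono) auto
      then show ?thesis by (simp add: algebra_simps)
    qed simp
  qed
  also have "\<dots> = 5 * real n * (\<Sum>i\<in>{1..n}. \<Sum>x\<in>cube n. pmf P x * U x i)"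
    by (subst sum.swap) (simp add: distrib_left sum.distrib sumP sum_distrib_left mult_ac)
  finally have "real (Suc k) * ?E (\<lambda>yss. discrepancy n (heavy n G yss) P (learned n G yss))
      \<le> real (Suc k) * (5 * real n * (\<Sum>i\<in>{1..n}. \<Sum>x\<in>cube n. pmf P x * U x i))"
    by (intro mult_left_mono) auto
  also have "\<dots> = 5 * real n * (\<Sum>i\<in>{1..n}. real (Suc k) * (\<Sum>x\<in>cube n. pmf P x * U x i))"
    by (simp add: sum_distrib_left mult_ac)
  also have "\<dots> \<le> 5 * real n * (\<Sum>i\<in>{1..n}. 2 ^ d)"
    by (intro mult_left_mono sum_mono sum_U_le) auto
  also have "\<dots> = 5 * real n ^ 2 * 2 ^ d" by (simp add: power2_eq_square)
  finally show ?thesis .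
qed

end

section \<open>A chi-square type statistic from two independent samples\<close>

definition chi :: "'a set \<Rightarrow> ('a \<Rightarrow> real) \<Rightarrow> real \<Rightarrow> 'a pmf \<Rightarrow> real" where
  "chi A q \<theta> P = (\<Sum>x\<in>A. (pmf P x - q x)\<^sup>2 / (q x + \<theta>))"

text \<open>Each inner sum is a count centred at its expectation under \<open>q\<close>. Drawing the
  two factors from independent samples leaves no diagonal term, so the mean needs no
  correction.\<close>

definition stat :: "'a set \<Rightarrow> ('a \<Rightarrow> real) \<Rightarrow> real \<Rightarrow> 'a list \<Rightarrow> 'a list \<Rightarrow> real" where
  "stat A q \<theta> ys zs = (\<Sum>x\<in>A. sum_list (map (\<lambda>y. of_bool (y = x) - q x) ys)
     * sum_list (map (\<lambda>z. of_bool (z = x) - q x) zs) / (q x + \<theta>))"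

lemma E_indicator_diff:
  assumes "finite (set_pmf P)"
  shows "E P (\<lambda>y. of_bool (y = x) - q) = pmf P x - q"
proof -
  have "E P (\<lambda>y. of_bool (y = x)) = pmf P x"
    by (simp flip: prob_conv_E add: measure_pmf_single)
  then show ?thesis by (simp add: E_diff[OF assms])
qed

text \<open>Constant shifts do not change a covariance, so this is the covariance of the indicators
  of two points.\<close>

lemma E_indicator_diff_mult:
  assumes "finite (set_pmf P)"
  shows "E P (\<lambda>y. (of_bool (y = x) - q) * (of_bool (y = x') - q')) - (pmf P x - q) * (pmf P x' - q')
       = of_bool (x = x') * pmf P x - pmf P x * pmf P x'"
proof -
  have e: "E P (\<lambda>y. of_bool (y = x)) = pmf P x" for x
    by (simp flip: prob_conv_E add: measure_pmf_single)
  have "E P (\<lambda>y. (of_bool (y = x) - q) * (of_bool (y = x') - q'))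
     = E P (\<lambda>y. of_bool (x = x') * of_bool (y = x) - q' * of_bool (y = x) - q * of_bool (y = x') + q * q')"
    by (intro E_cong) (auto simp: algebra_simps)
  also have "\<dots> = of_bool (x = x') * pmf P x - q' * pmf P x - q * pmf P x' + q * q'"
    by (simp add: E_diff[OF assms] E_add[OF assms] e)
  finally show ?thesis by (simp add: algebra_simps)
qed

section \<open>Mean and variance of the statistic\<close>

locale testing =
  fixes P :: "'a pmf" and A :: "'a set" and q :: "'a \<Rightarrow> real" and \<theta> :: real and m :: nat
  assumes finP: "finite (set_pmf P)" and finA: "finite A" and q: "\<And>x. 0 \<le> q x" and \<theta>: "0 < \<theta>"
begin

abbreviation "PP \<equiv> pair_pmf (replicate_pmf m P) (replicate_pmf m P)"
abbreviation "\<Delta> x \<equiv> pmf P x - q x"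
abbreviation "D x \<equiv> q x + \<theta>"
abbreviation "T \<equiv> chi A q \<theta> P"
abbreviation "S x ys \<equiv> sum_list (map (\<lambda>y. of_bool (y = x) - q x) ys)"
abbreviation "C x x' \<equiv> of_bool (x = x') * pmf P x - pmf P x * pmf P x'"

lemma D_pos: "0 < D x"
  using q[of x] \<theta> by simp

lemma finPP: "finite (set_pmf PP)"
  by (simp add: finite_set_replicate_pmf finP)

lemma E_PP_mult: "E PP (\<lambda>z. F (fst z) * H (snd z)) = E (replicate_pmf m P) F * E (replicate_pmf m P) H"
  by (simp add: E_pair finite_set_replicate_pmf finP)

lemma E_stat: "E PP (\<lambda>z. stat A q \<theta> (fst z) (snd z)) = (real m)\<^sup>2 * T"
proof -
  have e: "E PP (\<lambda>z. S x (fst z) * S x (snd z) / D x) = (real m)\<^sup>2 * ((\<Delta> x)\<^sup>2 / D x)" for x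
    by (simp add: E_PP_mult[of "S x" "S x"] E_sum_list[OF finP] E_indicator_diff[OF finP] power2_eq_square)
  then show ?thesis
    unfolding stat_def chi_def E_sum[OF finPP] e by (simp only: sum_distrib_left)
qed

text \<open>Expanding the square gives pairs \<open>x\<close>, \<open>x'\<close>; for each pair the
  two independent samples contribute the same second moment, hence its square.\<close>

lemma E_stat_square:
  "E PP (\<lambda>z. (stat A q \<theta> (fst z) (snd z))\<^sup>2)
     = (\<Sum>x\<in>A. \<Sum>x'\<in>A. ((real m)\<^sup>2 * (\<Delta> x * \<Delta> x') + real m * C x x')\<^sup>2 / (D x * D x'))"
proof -
  have "E PP (\<lambda>z. (stat A q \<theta> (fst z) (snd z))\<^sup>2)
    = E PP (\<lambda>z. \<Sum>x\<in>A. \<Sum>x'\<in>A. (S x (fst z) * S x' (fst z)) * (S x (snd z) * S x' (snd z)) / (D x * D x'))"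
    by (intro E_cong) (simp add: stat_def power2_eq_square sum_product mult_ac)
  also have "\<dots> = (\<Sum>x\<in>A. \<Sum>x'\<in>A. E PP (\<lambda>z. (S x (fst z) * S x' (fst z)) * (S x (snd z) * S x' (snd z)) / (D x * D x')))"
    by (simp only: E_sum[OF finPP])
  also have "\<dots> = (\<Sum>x\<in>A. \<Sum>x'\<in>A. (E (replicate_pmf m P) (\<lambda>ys. S x ys * S x' ys))\<^sup>2 / (D x * D x'))"
    by (intro sum.cong refl)
      (simp add: E_PP_mult[of "\<lambda>ys. S _ ys * S _ ys" "\<lambda>ys. S _ ys * S _ ys"] power2_eq_square)
  finally show ?thesis
    unfolding E_sum_list_mult[OF finP] E_indicator_diff[OF finP] E_indicator_diff_mult[OF finP] .
qed

lemma sum_pmf_le_1: "(\<Sum>x\<in>A. pmf P x) \<le> 1"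
  unfolding measure_measure_pmf_finite[OF finA, symmetric] by simp

text \<open>Subtracting the squared mean from \<open>E_stat_square\<close> leaves a term linear in
  the covariance \<open>C\<close>, with factor \<open>m ^ 3\<close>, and one quadratic in it, with
  factor \<open>m ^ 2\<close>.\<close>

lemma variance_stat_le:
  "E PP (\<lambda>z. (stat A q \<theta> (fst z) (snd z))\<^sup>2) - (E PP (\<lambda>z. stat A q \<theta> (fst z) (snd z)))\<^sup>2
    \<le> 2 * real m ^ 3 * (\<Sum>x\<in>A. (\<Delta> x)\<^sup>2 * pmf P x / (D x)\<^sup>2) + 2 * (real m)\<^sup>2 * (\<Sum>x\<in>A. (pmf P x)\<^sup>2 / (D x)\<^sup>2)"
proof -
  let ?m = "real m"
  have sq: "(?m\<^sup>2 * T)\<^sup>2 = (\<Sum>x\<in>A. \<Sum>x'\<in>A. (?m\<^sup>2 * (\<Delta> x * \<Delta> x'))\<^sup>2 / (D x * D x'))"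
    by (simp add: chi_def power2_eq_square sum_product sum_distrib_left mult_ac)
  have "E PP (\<lambda>z. (stat A q \<theta> (fst z) (snd z))\<^sup>2) - (E PP (\<lambda>z. stat A q \<theta> (fst z) (snd z)))\<^sup>2
    = (\<Sum>x\<in>A. \<Sum>x'\<in>A. 2 * ?m ^ 3 * (\<Delta> x * \<Delta> x' * C x x' / (D x * D x')) + ?m\<^sup>2 * ((C x x')\<^sup>2 / (D x * D x')))"
    unfolding E_stat E_stat_square sq sum_subtractf[symmetric]
    by (intro sum.cong refl) (simp add: diff_divide_distrib[symmetric] add_divide_distrib[symmetric]
        power2_eq_square power3_eq_cube algebra_simps)
  also have "\<dots> = 2 * ?m ^ 3 * (\<Sum>x\<in>A. \<Sum>x'\<in>A. \<Delta> x * \<Delta> x' * C x x' / (D x * D x'))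
      + ?m\<^sup>2 * (\<Sum>x\<in>A. \<Sum>x'\<in>A. (C x x')\<^sup>2 / (D x * D x'))"
    by (simp add: sum.distrib sum_distrib_left)
  also have "(\<Sum>x\<in>A. \<Sum>x'\<in>A. \<Delta> x * \<Delta> x' * C x x' / (D x * D x'))
      \<le> (\<Sum>x\<in>A. (\<Delta> x)\<^sup>2 * pmf P x / (D x)\<^sup>2)"
  proof -
    have split: "a * a' * (c - p * p') / (e * e') = a * a' * c / (e * e') - (a * p / e) * (a' * p' / e')"
      for a a' c p p' e e' :: real
      by (simp add: diff_divide_distrib right_diff_distrib mult_ac)
    have "(\<Sum>x\<in>A. \<Sum>x'\<in>A. \<Delta> x * \<Delta> x' * C x x' / (D x * D x'))
       = (\<Sum>x\<in>A. \<Sum>x'\<in>A. (if x = x' then (\<Delta> x)\<^sup>2 * pmf P x / (D x)\<^sup>2 else 0)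
             - (\<Delta> x * pmf P x / D x) * (\<Delta> x' * pmf P x' / D x'))"
      unfolding split by (intro sum.cong refl) (auto simp: power2_eq_square)
    also have "\<dots> = (\<Sum>x\<in>A. (\<Delta> x)\<^sup>2 * pmf P x / (D x)\<^sup>2) - (\<Sum>x\<in>A. \<Delta> x * pmf P x / D x)\<^sup>2"
      using finA by (simp add: sum_subtractf sum.delta sum_product power2_eq_square)
    finally show ?thesis by simp
  qed
  also have "(\<Sum>x\<in>A. \<Sum>x'\<in>A. (C x x')\<^sup>2 / (D x * D x')) \<le> 2 * (\<Sum>x\<in>A. (pmf P x)\<^sup>2 / (D x)\<^sup>2)"
  proof -
    have C2: "(C x x')\<^sup>2 \<le> (if x = x' then (pmf P x)\<^sup>2 else 0) + (pmf P x)\<^sup>2 * (pmf P x')\<^sup>2" for x x'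
    proof (cases "x = x'")
      case True
      have "0 \<le> pmf P x * (1 - pmf P x)" "pmf P x * (1 - pmf P x) \<le> pmf P x"
        by (auto intro!: mult_nonneg_nonneg mult_left_le simp: pmf_le_1)
      then have "(pmf P x * (1 - pmf P x))\<^sup>2 \<le> (pmf P x)\<^sup>2" by (intro power_mono)
      moreover have "C x x' = pmf P x * (1 - pmf P x)" using True by (simp add: right_diff_distrib)
      ultimately show ?thesis using True by (simp add: add_increasing2)
    qed (simp add: power_mult_distrib)
    have "(\<Sum>x\<in>A. \<Sum>x'\<in>A. (C x x')\<^sup>2 / (D x * D x'))
       \<le> (\<Sum>x\<in>A. \<Sum>x'\<in>A. (if x = x' then (pmf P x)\<^sup>2 / (D x)\<^sup>2 else 0) + ((pmf P x)\<^sup>2 / D x) * ((pmf P x')\<^sup>2 / D x'))"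
    proof (intro sum_mono)
      fix x x'
      have "(C x x')\<^sup>2 / (D x * D x') \<le> ((if x = x' then (pmf P x)\<^sup>2 else 0) + (pmf P x)\<^sup>2 * (pmf P x')\<^sup>2) / (D x * D x')"
        using D_pos[of x] D_pos[of x'] by (intro divide_right_mono C2) auto
      also have "\<dots> = (if x = x' then (pmf P x)\<^sup>2 / (D x)\<^sup>2 else 0) + ((pmf P x)\<^sup>2 / D x) * ((pmf P x')\<^sup>2 / D x')"
        by (auto simp: add_divide_distrib power2_eq_square)
      finally show "(C x x')\<^sup>2 / (D x * D x') \<le> \<dots>" .
    qed
    also have "\<dots> = (\<Sum>x\<in>A. (pmf P x)\<^sup>2 / (D x)\<^sup>2) + (\<Sum>x\<in>A. (pmf P x)\<^sup>2 / D x)\<^sup>2"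
      using finA by (simp add: sum.distrib sum.delta sum_product power2_eq_square)
    \<comment> \<open>Cauchy-Schwarz bounds the product term by the diagonal sum, whence the factor
      2.\<close>
    also have "(\<Sum>x\<in>A. (pmf P x)\<^sup>2 / D x)\<^sup>2 = (\<Sum>x\<in>A. pmf P x * (pmf P x / D x))\<^sup>2"
      by (simp add: power2_eq_square)
    also have "\<dots> \<le> (\<Sum>x\<in>A. (pmf P x)\<^sup>2) * (\<Sum>x\<in>A. (pmf P x / D x)\<^sup>2)"
      by (rule Cauchy_Schwarz_ineq_sum)
    also have "\<dots> \<le> 1 * (\<Sum>x\<in>A. (pmf P x / D x)\<^sup>2)"
    proof (intro mult_right_mono sum_nonneg)
      have "(\<Sum>x\<in>A. (pmf P x)\<^sup>2) \<le> (\<Sum>x\<in>A. pmf P x)"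
        by (intro sum_mono) (simp add: power2_eq_square mult_left_le pmf_le_1)
      with sum_pmf_le_1 show "(\<Sum>x\<in>A. (pmf P x)\<^sup>2) \<le> 1" by simp
    qed auto
    finally show ?thesis by (simp add: power_divide)
  qed
  finally show ?thesis by (simp add: mult_left_mono)
qed

lemma chi_nonneg: "0 \<le> T"
  unfolding chi_def using D_pos by (intro sum_nonneg divide_nonneg_pos) auto

lemma ratio_square_le:
  assumes "x \<in> A"
  shows "(\<Delta> x / D x)\<^sup>2 \<le> ((\<Delta> x)\<^sup>2 / D x) / \<theta>" "(\<Delta> x)\<^sup>2 / D x \<le> T"
proof -
  have "(\<Delta> x / D x)\<^sup>2 = ((\<Delta> x)\<^sup>2 / D x) * (1 / D x)" by (simp add: power2_eq_square)
  also have "\<dots> \<le> ((\<Delta> x)\<^sup>2 / D x) * (1 / \<theta>)"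
    using D_pos[of x] \<theta> q[of x] by (intro mult_left_mono) (auto simp: field_simps)
  finally show "(\<Delta> x / D x)\<^sup>2 \<le> ((\<Delta> x)\<^sup>2 / D x) / \<theta>" by simp
  show "(\<Delta> x)\<^sup>2 / D x \<le> T"
    unfolding chi_def using assms finA D_pos by (intro member_le_sum divide_nonneg_pos) auto
qed

text \<open>The quotient of \<open>pmf P x\<close> by \<open>D x\<close> splits into
  \<open>\<Delta> x / D x\<close> and \<open>q x / D x\<close>. The latter is at most 1; the former
  is at most \<open>sqrt (s / \<theta>)\<close>, because one summand of \<open>T\<close> is at most
  \<open>s\<close> and \<open>D x\<close> is at least \<open>\<theta>\<close>.\<close>

lemma sum_weighted_le:
  assumes "T \<le> s"
  shows "(\<Sum>x\<in>A. (\<Delta> x)\<^sup>2 * pmf P x / (D x)\<^sup>2) \<le> s * (1 + sqrt (s / \<theta>))"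
proof -
  have "(\<Delta> x)\<^sup>2 * pmf P x / (D x)\<^sup>2 \<le> (\<Delta> x)\<^sup>2 / D x * (1 + sqrt (s / \<theta>))" if x: "x \<in> A" for x
  proof -
    have "\<bar>\<Delta> x / D x\<bar> = sqrt ((\<Delta> x / D x)\<^sup>2)" by simp
    also have "\<dots> \<le> sqrt (s / \<theta>)"
    proof (rule real_sqrt_le_mono)
      have "((\<Delta> x)\<^sup>2 / D x) / \<theta> \<le> s / \<theta>"
        using ratio_square_le(2)[OF x] assms \<theta> by (intro divide_right_mono) auto
      with ratio_square_le(1)[OF x] show "(\<Delta> x / D x)\<^sup>2 \<le> s / \<theta>" by simp
    qed
    finally have r: "\<bar>\<Delta> x / D x\<bar> \<le> sqrt (s / \<theta>)" .
    have "pmf P x / D x = \<Delta> x / D x + q x / D x" by (simp add: add_divide_distrib[symmetric])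
    also have "q x / D x \<le> 1" using D_pos[of x] \<theta> by simp
    finally have "pmf P x / D x \<le> 1 + sqrt (s / \<theta>)" using r by linarith
    then have "(\<Delta> x)\<^sup>2 / D x * (pmf P x / D x) \<le> (\<Delta> x)\<^sup>2 / D x * (1 + sqrt (s / \<theta>))"
      using D_pos[of x] by (intro mult_left_mono) auto
    then show ?thesis by (simp add: power2_eq_square)
  qed
  then have "(\<Sum>x\<in>A. (\<Delta> x)\<^sup>2 * pmf P x / (D x)\<^sup>2) \<le> T * (1 + sqrt (s / \<theta>))"
    unfolding chi_def sum_distrib_right by (intro sum_mono)
  also have "\<dots> \<le> s * (1 + sqrt (s / \<theta>))"
    using assms \<theta> chi_nonneg by (intro mult_right_mono) (auto intro!: add_nonneg_nonneg)
  finally show ?thesis .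
qed

text \<open>The same splitting, now with \<open>(a + b)^2 \<le> 2 a^2 + 2 b^2\<close>.\<close>

lemma sum_ratio_square_le:
  assumes "T \<le> s" "real (card A) \<le> N"
  shows "(\<Sum>x\<in>A. (pmf P x)\<^sup>2 / (D x)\<^sup>2) \<le> 2 * (N + s / \<theta>)"
proof -
  have "(pmf P x)\<^sup>2 / (D x)\<^sup>2 \<le> 2 * (1 + ((\<Delta> x)\<^sup>2 / D x) / \<theta>)" if x: "x \<in> A" for x
  proof -
    have "pmf P x / D x = \<Delta> x / D x + q x / D x" by (simp add: add_divide_distrib[symmetric])
    then have "(pmf P x)\<^sup>2 / (D x)\<^sup>2 = (\<Delta> x / D x + q x / D x)\<^sup>2" by (simp flip: power_divide)
    also have "\<dots> \<le> 2 * (\<Delta> x / D x)\<^sup>2 + 2 * (q x / D x)\<^sup>2"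
      using sum_squares_bound[of "\<Delta> x / D x" "q x / D x"] by (simp add: power2_sum)
    also have "(q x / D x)\<^sup>2 \<le> 1"
      using D_pos[of x] \<theta> q[of x] by (intro power_le_one) auto
    also have "(\<Delta> x / D x)\<^sup>2 \<le> ((\<Delta> x)\<^sup>2 / D x) / \<theta>" using x by (rule ratio_square_le)
    finally show ?thesis by simp
  qed
  then have "(\<Sum>x\<in>A. (pmf P x)\<^sup>2 / (D x)\<^sup>2) \<le> (\<Sum>x\<in>A. 2 * (1 + ((\<Delta> x)\<^sup>2 / D x) / \<theta>))"
    by (intro sum_mono)
  also have "\<dots> = 2 * (real (card A) + T / \<theta>)"
    unfolding chi_def sum_divide_distrib sum_distrib_left[symmetric] by (simp only: sum.distrib) simp
  also have "\<dots> \<le> 2 * (N + s / \<theta>)"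
    using assms \<theta> by (intro mult_left_mono add_mono divide_right_mono) auto
  finally show ?thesis .
qed

text \<open>\<open>s\<close> is the scale for Chebyshev's inequality: \<open>T\<close> itself when
  \<open>T\<close> is large, \<open>\<epsilon>^2 / 2\<close> when it is small. The sample size makes
  \<open>m * s\<close> at least \<open>500 * sqrt N\<close>, and the choice of
  \<open>\<theta>\<close> makes \<open>sqrt (s / \<theta>)\<close> at most
  \<open>m * s / 300\<close>; both sums of \<open>variance_stat_le\<close> are then small against
  \<open>m ^ 4 * s ^ 2\<close>.\<close>

lemma variance_stat_le':
  assumes \<epsilon>: "0 < \<epsilon>" "\<epsilon> \<le> 1" and N: "1 \<le> N" "real (card A) \<le> N" and th: "\<theta> = \<epsilon>\<^sup>2 / (4 * N)"
    and m: "1000 * sqrt N / \<epsilon>\<^sup>2 \<le> real m" and s: "T \<le> s" "\<epsilon>\<^sup>2 / 2 \<le> s"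
  shows "E PP (\<lambda>z. (stat A q \<theta> (fst z) (snd z))\<^sup>2) - (E PP (\<lambda>z. stat A q \<theta> (fst z) (snd z)))\<^sup>2
    \<le> real m ^ 4 * s\<^sup>2 / 90"
proof -
  let ?m = "real m"
  have e2: "0 < \<epsilon>\<^sup>2" "\<epsilon>\<^sup>2 \<le> 1" using \<epsilon> by (auto simp: power_le_one)
  have s0: "0 < s" using s(2) e2 by linarith
  have r: "1 \<le> sqrt N" using N by simp
  have m1: "1000 * sqrt N \<le> ?m * \<epsilon>\<^sup>2" using m e2 by (simp add: divide_le_eq)
  then have m2: "1000 \<le> ?m * \<epsilon>\<^sup>2" using r by linarith
  have m0: "0 < ?m"
    using m2 e2 by (metis mult_zero_left not_numeral_le_zero of_nat_0_less_iff gr0I of_nat_0)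
  have msN: "500 * sqrt N \<le> ?m * s"
    using m1 mult_left_mono[OF s(2), of ?m] by simp
  have ms: "500 \<le> ?m * s" using msN r by linarith
  have B: "sqrt (s / \<theta>) \<le> ?m * s / 300"
  proof (rule real_le_lsqrt)
    have "(1000 * sqrt N)\<^sup>2 \<le> (?m * \<epsilon>\<^sup>2)\<^sup>2" using m1 r by (intro power_mono) auto
    also have "(1000 * sqrt N)\<^sup>2 = 10 ^ 6 * N" using N by (simp add: power_mult_distrib)
    also have "(?m * \<epsilon>\<^sup>2)\<^sup>2 = ?m\<^sup>2 * (\<epsilon>\<^sup>2 * \<epsilon>\<^sup>2)" by (simp add: power2_eq_square mult_ac)
    \<comment> \<open>One factor \<open>\<epsilon>^2\<close> is traded for \<open>2 * s\<close>; the
      other cancels against the one in \<open>\<theta>\<close>.\<close>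
    also have "?m\<^sup>2 * (\<epsilon>\<^sup>2 * \<epsilon>\<^sup>2) \<le> ?m\<^sup>2 * (\<epsilon>\<^sup>2 * (2 * s))" using s e2 by (intro mult_left_mono) auto
    finally have *: "500000 * N \<le> ?m\<^sup>2 * s * \<epsilon>\<^sup>2" by (simp add: mult_ac)
    have "s / \<theta> = 4 * N * s / \<epsilon>\<^sup>2" using th e2 N by simp
    also have "\<dots> \<le> ?m\<^sup>2 * s * s / 90000"
    proof -
      have "90000 * (4 * N * s) \<le> (500000 * N) * s" using s0 N by simp
      also have "\<dots> \<le> (?m\<^sup>2 * s * \<epsilon>\<^sup>2) * s" using * s0 by (intro mult_right_mono) auto
      finally show ?thesis using e2 by (simp add: divide_le_eq mult_ac)
    qed
    finally show "s / \<theta> \<le> (?m * s / 300)\<^sup>2" by (simp add: power2_eq_square mult_ac)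
  qed (use s0 \<theta> m0 in auto)
  have t1: "2 * ?m ^ 3 * (s * (1 + sqrt (s / \<theta>))) \<le> ?m ^ 4 * s\<^sup>2 * (16 / 1500)"
  proof -
    \<comment> \<open>The constant is \<open>1 / 500 + 1 / 300 = 8 / 1500\<close>.\<close>
    have "1 + sqrt (s / \<theta>) \<le> ?m * s * (8 / 1500)" using ms B by (simp add: field_simps)
    then have "2 * ?m ^ 3 * s * (1 + sqrt (s / \<theta>)) \<le> 2 * ?m ^ 3 * s * (?m * s * (8 / 1500))"
      using s0 by (intro mult_left_mono) auto
    then show ?thesis by (simp add: power2_eq_square eval_nat_numeral mult_ac)
  qed
  have t2: "2 * ?m\<^sup>2 * (2 * (N + s / \<theta>)) \<le> ?m ^ 4 * s\<^sup>2 * (1 / 15000)"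
  proof -
    have "(500 * sqrt N)\<^sup>2 \<le> (?m * s)\<^sup>2" using msN r by (intro power_mono) auto
    then have n1: "N \<le> (?m * s)\<^sup>2 / 250000" using N by (simp add: power_mult_distrib)
    have "s / \<theta> = (sqrt (s / \<theta>))\<^sup>2" using s0 \<theta> by simp
    also have "\<dots> \<le> (?m * s / 300)\<^sup>2" using B s0 \<theta> by (intro power_mono) auto
    finally have "s / \<theta> \<le> (?m * s)\<^sup>2 / 90000" by (simp add: power_divide)
    \<comment> \<open>Here \<open>4 / 250000 + 4 / 90000\<close> is below
      \<open>1 / 15000\<close>.\<close>
    with n1 zero_le_power2[of "?m * s"] have "4 * (N + s / \<theta>) \<le> (?m * s)\<^sup>2 * (1 / 15000)"
      by (simp only: distrib_left)
    then have "?m\<^sup>2 * (4 * (N + s / \<theta>)) \<le> ?m\<^sup>2 * ((?m * s)\<^sup>2 * (1 / 15000))"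
      by (intro mult_left_mono) auto
    then show ?thesis by (simp add: power_mult_distrib mult_ac eval_nat_numeral power2_eq_square)
  qed
  have "E PP (\<lambda>z. (stat A q \<theta> (fst z) (snd z))\<^sup>2) - (E PP (\<lambda>z. stat A q \<theta> (fst z) (snd z)))\<^sup>2
    \<le> 2 * ?m ^ 3 * (s * (1 + sqrt (s / \<theta>))) + 2 * ?m\<^sup>2 * (2 * (N + s / \<theta>))"
    using sum_weighted_le[OF s(1)] sum_ratio_square_le[OF s(1) N(2)]
    by (intro order_trans[OF variance_stat_le] add_mono mult_left_mono) auto
  also have "\<dots> \<le> ?m ^ 4 * s\<^sup>2 * (16 / 1500) + ?m ^ 4 * s\<^sup>2 * (1 / 15000)"
    using t1 t2 by (rule add_mono)
  also have "\<dots> \<le> ?m ^ 4 * s\<^sup>2 / 90"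
    using zero_le_power[of ?m 4] zero_le_power2[of s] mult_nonneg_nonneg[of "?m ^ 4" "s\<^sup>2"] by simp
  finally show ?thesis .
qed

end

section \<open>Identity testing in Hellinger distance\<close>

text \<open>If both numbers are below \<open>\<theta>\<close>, the squared difference of roots is at
  most their maximum. Otherwise \<open>a + b\<close> is at least \<open>(b + \<theta>) / 2\<close>,
  and multiplying by \<open>(sqrt a + sqrt b)^2\<close>, which is at least \<open>a + b\<close>,
  turns the difference of roots into \<open>a - b\<close>.\<close>

lemma sqrt_diff_square_le:
  fixes a b \<theta> :: real
  assumes "0 \<le> a" "0 \<le> b" "0 < \<theta>"
  shows "(sqrt a - sqrt b)\<^sup>2 \<le> 2 * ((a - b)\<^sup>2 / (b + \<theta>)) + \<theta>"
proof (cases "max a b < \<theta>")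
  case True
  have "(sqrt a - sqrt b)\<^sup>2 = a + b - 2 * (sqrt a * sqrt b)"
    using assms by (simp add: power2_diff)
  also have "sqrt a * sqrt b \<ge> min a b"
  proof -
    have "min a b * min a b \<le> a * b" using assms by (intro mult_mono) auto
    then have "min a b \<le> sqrt (a * b)" by (intro real_le_rsqrt) (simp add: power2_eq_square)
    then show ?thesis using assms by (simp add: real_sqrt_mult)
  qed
  then have "a + b - 2 * (sqrt a * sqrt b) \<le> max a b" using assms by (auto simp: min_def max_def split: if_splits)
  finally have "(sqrt a - sqrt b)\<^sup>2 \<le> \<theta>" using True by linarith
  then show ?thesis using assms by (simp add: add_increasing)
next
  case False
  have "(sqrt a - sqrt b)\<^sup>2 * ((b + \<theta>) / 2) \<le> (sqrt a - sqrt b)\<^sup>2 * (sqrt a + sqrt b)\<^sup>2"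
  proof (rule mult_left_mono)
    have "(b + \<theta>) / 2 \<le> a + b" using False assms by (auto simp: max_def split: if_splits)
    also have "\<dots> \<le> (sqrt a + sqrt b)\<^sup>2" using assms by (simp add: power2_sum)
    finally show "(b + \<theta>) / 2 \<le> (sqrt a + sqrt b)\<^sup>2" .
  qed simp
  also have "\<dots> = ((sqrt a - sqrt b) * (sqrt a + sqrt b))\<^sup>2" by (simp add: power_mult_distrib)
  also have "(sqrt a - sqrt b) * (sqrt a + sqrt b) = a - b"
    using assms by (simp add: algebra_simps)
  finally have "(sqrt a - sqrt b)\<^sup>2 \<le> 2 * ((a - b)\<^sup>2 / (b + \<theta>))"
    using assms by (simp add: field_simps)
  then show ?thesis using assms(3) by simp
qed

section \<open>Completeness and soundness of the identity test\<close>

locale identity_testing =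
  fixes n :: nat and \<epsilon> :: real and m :: nat and P :: "(nat \<Rightarrow> bool) pmf"
    and A :: "(nat \<Rightarrow> bool) set" and Q :: "(nat \<Rightarrow> bool) pmf"
  assumes P: "P \<in> distributions n" and A: "A \<subseteq> cube n"
    and \<epsilon>: "0 < \<epsilon>" "\<epsilon> \<le> 1" and m: "1000 * sqrt (2 ^ n) / \<epsilon>\<^sup>2 \<le> real m"
    and Q: "\<And>x. x \<in> A \<Longrightarrow> 0 < pmf Q x" "Q \<in> distributions n"
begin

text \<open>Three checks for three ways of being far apart: the mass of \<open>Q\<close> off
  \<open>A\<close>, which is computed exactly; the mass of \<open>P\<close> off \<open>A\<close>,
  estimated from the first sample; and the truncated chi-square distance on \<open>A\<close>. The
  body does not mention \<open>P\<close>, so a tester may use it.\<close>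

definition verdict :: "(nat \<Rightarrow> bool) list \<Rightarrow> (nat \<Rightarrow> bool) list \<Rightarrow> bool" where
  "verdict ys zs \<longleftrightarrow> (\<Sum>x\<in>cube n - A. pmf Q x) \<le> \<epsilon>\<^sup>2 / 8
     \<and> real (hits (\<lambda>y. y \<notin> A) ys) \<le> real m * (\<epsilon>\<^sup>2 / 4)
     \<and> stat A (pmf Q) (\<epsilon>\<^sup>2 / (4 * 2 ^ n)) ys zs \<le> (real m)\<^sup>2 * (\<epsilon>\<^sup>2 / 4)"

end

sublocale identity_testing \<subseteq> testing P A "pmf Q" "\<epsilon>\<^sup>2 / (4 * 2 ^ n)" m
  using P A \<epsilon> by unfold_locales (auto intro: finite_distributions finite_subset)

context identity_testing
begin

lemma card_A: "real (card A) \<le> 2 ^ n"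
  using card_mono[OF finite_cube A] by (simp add: card_cube flip: of_nat_le_iff)

lemmas variance = variance_stat_le'[OF \<epsilon> _ card_A refl m]

abbreviation "out \<equiv> measure_pmf.prob P {y. y \<notin> A}"

lemma out: "out = (\<Sum>x\<in>cube n. of_bool (x \<notin> A) * pmf P x)"
proof -
  have "out = (\<Sum>x\<in>cube n. pmf P x * of_bool (x \<notin> A))"
    unfolding prob_conv_E using P by (intro E_conv_sum) (auto simp: distributions_def)
  then show ?thesis by (simp add: mult.commute)
qed

lemma hits_sum_list: "real (hits B ys) = sum_list (map (\<lambda>y. of_bool (B y)) ys)"
  by (induction ys) auto

lemma E_hits: "E (replicate_pmf m P) (\<lambda>ys. real (hits (\<lambda>y. y \<notin> A) ys)) = real m * out"
  unfolding hits_sum_list E_sum_list[OF finP] prob_conv_E ..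

lemma E_hits_square: "E (replicate_pmf m P) (\<lambda>ys. (real (hits (\<lambda>y. y \<notin> A) ys))\<^sup>2) = (real m * out)\<^sup>2 + real m * (out - out\<^sup>2)"
proof -
  have "E P (\<lambda>y. of_bool (y \<notin> A) * of_bool (y \<notin> A)) = out"
    unfolding prob_conv_E by (intro E_cong) auto
  then show ?thesis
    unfolding hits_sum_list power2_eq_square E_sum_list_mult[OF finP] by (simp add: prob_conv_E power2_eq_square)
qed

lemma prob_PP_fst: "measure_pmf.prob PP {z. R (fst z)} = measure_pmf.prob (replicate_pmf m P) {ys. R ys}"
proof -
  have "measure_pmf.prob PP {z. R (fst z)} = measure_pmf.prob (map_pmf fst PP) {ys. R ys}"
    by (simp add: measure_map_pmf vimage_def del: map_fst_pair_pmf)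
  then show ?thesis by (simp add: map_fst_pair_pmf)
qed

lemma e2: "0 < \<epsilon>\<^sup>2" using \<epsilon> by simp

lemma m_ge: "1000 \<le> real m * \<epsilon>\<^sup>2"
proof -
  have "1000 * sqrt (2 ^ n) \<le> real m * \<epsilon>\<^sup>2" using m e2 by (simp add: divide_le_eq)
  moreover have "1 \<le> sqrt (2 ^ n)" by simp
  ultimately show ?thesis by linarith
qed

lemma m_pos: "0 < real m"
  using m_ge e2 by (cases "m = 0") auto

text \<open>The discrepancy bounds all three checked quantities by \<open>\<epsilon>^2 / 48\<close>,
  so the first check passes. The second fails with probability at most
  \<open>(1 / 48) / (1 / 4) = 1 / 12\<close> by Markov's inequality. For the third to fail, the
  statistic must exceed its mean by at least \<open>m ^ 2 * \<epsilon>^2 / 5\<close>, since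
  \<open>1 / 48 + 1 / 5\<close> is below \<open>1 / 4\<close>; Chebyshev's inequality with
  \<open>s = \<epsilon>^2 / 2\<close> gives another \<open>1 / 12\<close>.\<close>

lemma verdict_complete:
  assumes "discrepancy n A P Q \<le> \<epsilon>\<^sup>2 / 48"
  shows "measure_pmf.prob PP {z. \<not> verdict (fst z) (snd z)} \<le> 1 / 6"
proof -
  have cube_A: "(\<Sum>x\<in>cube n. of_bool (x \<in> A) * f x) = (\<Sum>x\<in>A. f x)" for f :: "_ \<Rightarrow> real"
    using A by (intro sum.mono_neutral_cong_right) auto
  have disc: "discrepancy n A P Q = (\<Sum>x\<in>A. (pmf P x - pmf Q x)\<^sup>2 / pmf Q x) + out + (\<Sum>x\<in>cube n - A. pmf Q x)"
  proof -
    have "(\<Sum>x\<in>cube n - A. pmf Q x) = (\<Sum>x\<in>cube n. of_bool (x \<notin> A) * pmf Q x)"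
      by (intro sum.mono_neutral_cong_left) auto
    then show ?thesis
      unfolding discrepancy_def sum.distrib cube_A by (simp add: sum.distrib distrib_left out)
  qed
  have nn: "0 \<le> (\<Sum>x\<in>A. (pmf P x - pmf Q x)\<^sup>2 / pmf Q x)" "0 \<le> out" "0 \<le> (\<Sum>x\<in>cube n - A. pmf Q x)"
    by (auto intro!: sum_nonneg)
  have T_le: "T \<le> (\<Sum>x\<in>A. (pmf P x - pmf Q x)\<^sup>2 / pmf Q x)"
    unfolding chi_def using Q \<theta> by (intro sum_mono divide_left_mono mult_pos_pos add_pos_pos) auto
  with assms nn have T: "T \<le> \<epsilon>\<^sup>2 / 48" and outP: "out \<le> \<epsilon>\<^sup>2 / 48"
    and outQ: "(\<Sum>x\<in>cube n - A. pmf Q x) \<le> \<epsilon>\<^sup>2 / 8"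
    unfolding disc using e2 by linarith+
  let ?B = "\<lambda>ys. real m * (\<epsilon>\<^sup>2 / 4) \<le> real (hits (\<lambda>y. y \<notin> A) ys)"
  let ?st = "\<lambda>z. stat A (pmf Q) (\<epsilon>\<^sup>2 / (4 * 2 ^ n)) (fst z) (snd z)"
  let ?C = "\<lambda>z. (real m)\<^sup>2 * (\<epsilon>\<^sup>2 / 5) \<le> \<bar>?st z - E PP ?st\<bar>"
  have "measure_pmf.prob PP {z. \<not> verdict (fst z) (snd z)} \<le> measure_pmf.prob PP {z. ?B (fst z) \<or> ?C z}"
  proof (intro measure_pmf.finite_measure_mono subsetI CollectI)
    fix z assume "z \<in> {z. \<not> verdict (fst z) (snd z)}"
    then have "\<not> real (hits (\<lambda>y. y \<notin> A) (fst z)) \<le> real m * (\<epsilon>\<^sup>2 / 4) \<or> \<not> ?st z \<le> (real m)\<^sup>2 * (\<epsilon>\<^sup>2 / 4)"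
      using outQ by (auto simp: verdict_def)
    moreover have "?C z" if "\<not> ?st z \<le> (real m)\<^sup>2 * (\<epsilon>\<^sup>2 / 4)"
    proof -
      have "(real m)\<^sup>2 * T \<le> (real m)\<^sup>2 * (\<epsilon>\<^sup>2 / 48)" using T by (intro mult_left_mono) auto
      moreover have "(real m)\<^sup>2 * (\<epsilon>\<^sup>2 / 48) + (real m)\<^sup>2 * (\<epsilon>\<^sup>2 / 5) \<le> (real m)\<^sup>2 * (\<epsilon>\<^sup>2 / 4)"
        using e2 by (simp add: distrib_left[symmetric] mult_left_mono)
      ultimately show ?thesis using that unfolding E_stat by linarith
    qed
    ultimately show "?B (fst z) \<or> ?C z" by linarith
  qed simp
  also have "\<dots> \<le> measure_pmf.prob PP {z. ?B (fst z)} + measure_pmf.prob PP {z. ?C z}"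
    by (rule prob_Un_le)
  also have "measure_pmf.prob PP {z. ?B (fst z)} \<le> 1 / 12"
  proof -
    have "measure_pmf.prob PP {z. ?B (fst z)} \<le> real m * out / (real m * (\<epsilon>\<^sup>2 / 4))"
      unfolding prob_PP_fst[of ?B] E_hits[symmetric]
      using m_pos e2 by (intro markov_ineq finite_set_replicate_pmf finP) auto
    also have "\<dots> \<le> 1 / 12" using outP m_pos e2 by (simp add: field_simps)
    finally show ?thesis .
  qed
  also have "measure_pmf.prob PP {z. ?C z} \<le> 1 / 12"
  proof -
    have eq: "((real m)\<^sup>2 * (\<epsilon>\<^sup>2 / 5))\<^sup>2 = real m ^ 4 * (\<epsilon>\<^sup>2)\<^sup>2 / 25"
      by (simp add: power_mult_distrib power_divide flip: power_mult)
    have "T \<le> \<epsilon>\<^sup>2 / 2" using T e2 by linarith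
    from variance[OF _ this] have "(E PP (\<lambda>z. (?st z)\<^sup>2) - (E PP ?st)\<^sup>2) / ((real m)\<^sup>2 * (\<epsilon>\<^sup>2 / 5))\<^sup>2
       \<le> (real m ^ 4 * (\<epsilon>\<^sup>2 / 2)\<^sup>2 / 90) / ((real m)\<^sup>2 * (\<epsilon>\<^sup>2 / 5))\<^sup>2"
      by (intro divide_right_mono) auto
    also note eq
    also have "(real m ^ 4 * (\<epsilon>\<^sup>2 / 2)\<^sup>2 / 90) / (real m ^ 4 * (\<epsilon>\<^sup>2)\<^sup>2 / 25) \<le> 1 / 12"
      using m_pos e2 by (simp add: power_divide)
    finally have "(E PP (\<lambda>z. (?st z)\<^sup>2) - (E PP ?st)\<^sup>2) / ((real m)\<^sup>2 * (\<epsilon>\<^sup>2 / 5))\<^sup>2 \<le> 1 / 12"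
      by (simp only: eq)
    then show ?thesis
      using m_pos e2 by (intro order_trans[OF chebyshev_ineq[OF finPP]]) auto
  qed
  finally show ?thesis by simp
qed

text \<open>On \<open>A\<close> this sums \<open>sqrt_diff_square_le\<close>, off \<open>A\<close>
  the trivial bound by the two masses; \<open>\<theta>\<close> over \<open>2 ^ n\<close> points
  totals \<open>\<epsilon>^2 / 4\<close>.\<close>

lemma hellinger_square_le:
  "2 * (hellinger n P Q)\<^sup>2 \<le> 2 * T + \<epsilon>\<^sup>2 / 4 + out + (\<Sum>x\<in>cube n - A. pmf Q x)"
proof -
  let ?th = "\<epsilon>\<^sup>2 / (4 * 2 ^ n)"
  have "2 * (hellinger n P Q)\<^sup>2 = (\<Sum>x\<in>cube n. (sqrt (pmf P x) - sqrt (pmf Q x))\<^sup>2)"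
    unfolding hellinger_def by (simp add: sum_nonneg)
  also have "\<dots> \<le> (\<Sum>x\<in>cube n. of_bool (x \<in> A) * (2 * ((pmf P x - pmf Q x)\<^sup>2 / (pmf Q x + ?th)))
      + ?th + of_bool (x \<notin> A) * pmf P x + of_bool (x \<notin> A) * pmf Q x)"
  proof (rule sum_mono)
    fix x
    have "(sqrt (pmf P x) - sqrt (pmf Q x))\<^sup>2 \<le> pmf P x + pmf Q x" by (simp add: power2_diff)
    moreover have "(sqrt (pmf P x) - sqrt (pmf Q x))\<^sup>2 \<le> 2 * ((pmf P x - pmf Q x)\<^sup>2 / (pmf Q x + ?th)) + ?th"
      using \<theta> by (intro sqrt_diff_square_le) auto
    ultimately show "(sqrt (pmf P x) - sqrt (pmf Q x))\<^sup>2 \<le> of_bool (x \<in> A) * (2 * ((pmf P x - pmf Q x)\<^sup>2 / (pmf Q x + ?th)))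
      + ?th + of_bool (x \<notin> A) * pmf P x + of_bool (x \<notin> A) * pmf Q x"
      using \<theta> by (cases "x \<in> A") auto
  qed
  also have "\<dots> = 2 * T + \<epsilon>\<^sup>2 / 4 + out + (\<Sum>x\<in>cube n - A. pmf Q x)"
  proof -
    have "(\<Sum>x\<in>cube n - A. pmf Q x) = (\<Sum>x\<in>cube n. of_bool (x \<notin> A) * pmf Q x)"
      by (intro sum.mono_neutral_cong_left) auto
    moreover have "2 * T = (\<Sum>x\<in>cube n. of_bool (x \<in> A) * (2 * ((pmf P x - pmf Q x)\<^sup>2 / (pmf Q x + ?th))))"
      unfolding chi_def sum_distrib_left using A by (intro sum.mono_neutral_cong_left) auto
    ultimately show ?thesis unfolding out by (simp add: sum.distrib card_cube)
  qed
  finally show ?thesis .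
qed

text \<open>If the mass of \<open>Q\<close> off \<open>A\<close> is large, the first check always
  fails. If \<open>P\<close> has mass at least \<open>\<epsilon>^2 / 2\<close> there, the count
  concentrates above its threshold. Otherwise \<open>hellinger_square_le\<close> leaves
  \<open>T\<close> at least \<open>\<epsilon>^2 / 2\<close>, so passing the third check means
  falling below half the mean.\<close>

lemma verdict_sound:
  assumes "\<epsilon> \<le> hellinger n P Q"
  shows "measure_pmf.prob PP {z. verdict (fst z) (snd z)} \<le> 1 / 6"
proof (cases "(\<Sum>x\<in>cube n - A. pmf Q x) \<le> \<epsilon>\<^sup>2 / 8")
  case False
  then have "{z. verdict (fst z) (snd z)} = {}" by (auto simp: verdict_def)
  then show ?thesis by simp
next
  case outQ: True
  show ?thesis
  proof (cases "\<epsilon>\<^sup>2 / 2 \<le> out")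
    case True
    let ?h = "\<lambda>ys. real (hits (\<lambda>y. y \<notin> A) ys)"
    let ?R = "replicate_pmf m P"
    have o: "0 < out" using True e2 by linarith
    have "measure_pmf.prob PP {z. verdict (fst z) (snd z)}
       \<le> measure_pmf.prob PP {z. real m * out / 2 \<le> \<bar>?h (fst z) - E ?R ?h\<bar>}"
    proof (intro measure_pmf.finite_measure_mono subsetI CollectI)
      fix z assume "z \<in> {z. verdict (fst z) (snd z)}"
      then have "?h (fst z) \<le> real m * (\<epsilon>\<^sup>2 / 4)" by (simp add: verdict_def)
      also have "\<dots> \<le> real m * (out / 2)" using True by (intro mult_left_mono) auto
      finally show "real m * out / 2 \<le> \<bar>?h (fst z) - E ?R ?h\<bar>" unfolding E_hits by simp
    qed simp
    also have "\<dots> \<le> (E ?R (\<lambda>ys. (?h ys)\<^sup>2) - (E ?R ?h)\<^sup>2) / (real m * out / 2)\<^sup>2"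
      unfolding prob_PP_fst[of "\<lambda>ys. real m * out / 2 \<le> \<bar>?h ys - E ?R ?h\<bar>"]
      using m_pos o by (intro chebyshev_ineq finite_set_replicate_pmf finP) auto
    also have "\<dots> \<le> (real m * out) / (real m * out / 2)\<^sup>2"
      unfolding E_hits E_hits_square by (intro divide_right_mono) (auto simp: algebra_simps)
    also have "\<dots> = 4 / (real m * out)" using m_pos o by (simp add: power2_eq_square)
    also have "\<dots> \<le> 4 / 500"
    proof (intro divide_left_mono)
      show "500 \<le> real m * out" using m_ge mult_left_mono[OF True, of "real m"] by simp
    qed (use m_pos o in auto)
    finally show ?thesis by simp
  next
    case False
    let ?st = "\<lambda>z. stat A (pmf Q) (\<epsilon>\<^sup>2 / (4 * 2 ^ n)) (fst z) (snd z)"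
    have "\<epsilon>\<^sup>2 \<le> (hellinger n P Q)\<^sup>2" using assms \<epsilon> by (intro power_mono) auto
    with hellinger_square_le False outQ e2 have T: "\<epsilon>\<^sup>2 / 2 \<le> T" by linarith
    have Tpos: "0 < T" using T e2 by linarith
    have "measure_pmf.prob PP {z. verdict (fst z) (snd z)}
       \<le> measure_pmf.prob PP {z. (real m)\<^sup>2 * T / 2 \<le> \<bar>?st z - E PP ?st\<bar>}"
    proof (intro measure_pmf.finite_measure_mono subsetI CollectI)
      fix z assume "z \<in> {z. verdict (fst z) (snd z)}"
      then have "?st z \<le> (real m)\<^sup>2 * (\<epsilon>\<^sup>2 / 4)" by (simp add: verdict_def)
      also have "\<dots> \<le> (real m)\<^sup>2 * (T / 2)" using T by (intro mult_left_mono) auto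
      finally show "(real m)\<^sup>2 * T / 2 \<le> \<bar>?st z - E PP ?st\<bar>" unfolding E_stat by linarith
    qed simp
    also have "\<dots> \<le> (E PP (\<lambda>z. (?st z)\<^sup>2) - (E PP ?st)\<^sup>2) / ((real m)\<^sup>2 * T / 2)\<^sup>2"
      using m_pos Tpos by (intro chebyshev_ineq finPP) auto
    also have "\<dots> \<le> (real m ^ 4 * T\<^sup>2 / 90) / ((real m)\<^sup>2 * T / 2)\<^sup>2"
      using variance[OF _ order_refl T] by (intro divide_right_mono) auto
    also have "((real m)\<^sup>2 * T / 2)\<^sup>2 = real m ^ 4 * T\<^sup>2 / 4"
      by (simp add: power_mult_distrib power_divide flip: power_mult)
    also have "(real m ^ 4 * T\<^sup>2 / 90) / (real m ^ 4 * T\<^sup>2 / 4) \<le> 1 / 6"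
      using m_pos Tpos by simp
    finally show ?thesis .
  qed
qed

end

section \<open>The testers\<close>

text \<open>Condition on the first component and bound the conditional probability by 1 on the bad
  set.\<close>

lemma prob_pair_le:
  assumes "finite (set_pmf p)" "finite (set_pmf q)"
    and "\<And>y. y \<in> set_pmf p \<Longrightarrow> \<not> bad y \<Longrightarrow> measure_pmf.prob q {z. R y z} \<le> c" "0 \<le> c"
  shows "measure_pmf.prob (pair_pmf p q) {yz. R (fst yz) (snd yz)} \<le> measure_pmf.prob p {y. bad y} + c"
proof -
  have "measure_pmf.prob (pair_pmf p q) {yz. R (fst yz) (snd yz)} = E p (\<lambda>y. measure_pmf.prob q {z. R y z})"
    unfolding prob_conv_E E_pair[OF assms(1,2)] by simp
  also have "\<dots> \<le> E p (\<lambda>y. of_bool (bad y) + c)"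
    using assms(3,4) by (intro E_mono assms(1)) (auto simp: add_increasing2)
  also have "\<dots> = measure_pmf.prob p {y. bad y} + c"
    by (simp add: E_add[OF assms(1)] prob_conv_E)
  finally show ?thesis .
qed

text \<open>A Chernoff bound: the event says that \<open>4 ^ hits\<close> is at least
  \<open>2 ^ r\<close>, and by independence the mean of \<open>4 ^ hits\<close> is at most
  \<open>(1 + 3 / 4) ^ r\<close>.\<close>

lemma majority_error:
  assumes fin: "finite (set_pmf p)" and R: "measure_pmf.prob p {x. R x} \<le> 1 / 4"
  shows "measure_pmf.prob (replicate_pmf r p) {xs. r \<le> 2 * hits R xs} \<le> (7 / 8) ^ r"
proof -
  have E4: "E (replicate_pmf r p) (\<lambda>xs. 4 ^ hits R xs) = (1 + 3 * measure_pmf.prob p {x. R x}) ^ r"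
  proof (induction r)
    case (Suc r)
    have "E (replicate_pmf (Suc r) p) (\<lambda>xs. 4 ^ hits R xs)
        = E p (\<lambda>y. (1 + 3 * of_bool (R y)) * E (replicate_pmf r p) (\<lambda>xs. 4 ^ hits R xs))"
      unfolding E_replicate_Suc[OF fin] by (intro E_cong) simp
    also have "\<dots> = (1 + 3 * measure_pmf.prob p {x. R x}) * E (replicate_pmf r p) (\<lambda>xs. 4 ^ hits R xs)"
      by (simp add: E_add[OF fin] prob_conv_E)
    finally show ?case by (simp add: Suc.IH)
  qed simp
  have "{xs. r \<le> 2 * hits R xs} = {xs. (2::real) ^ r \<le> 4 ^ hits R xs}"
  proof -
    have "(4::real) ^ k = 2 ^ (2 * k)" for k by (simp add: power_mult)
    then show ?thesis by simp
  qed
  then have "measure_pmf.prob (replicate_pmf r p) {xs. r \<le> 2 * hits R xs}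
      \<le> E (replicate_pmf r p) (\<lambda>xs. 4 ^ hits R xs) / 2 ^ r"
    by (simp only:) (intro markov_ineq finite_set_replicate_pmf fin, auto)
  also have "\<dots> \<le> (7 / 4) ^ r / 2 ^ r"
    unfolding E4 using R by (intro divide_right_mono power_mono) auto
  also have "\<dots> = (7 / 8) ^ r" by (simp flip: power_divide)
  finally show ?thesis .
qed

lemma testable_withI:
  assumes "\<And>P. P \<in> distributions n \<Longrightarrow> Yes P \<Longrightarrow> measure_pmf.prob (replicate_pmf m P) {xs. \<not> acc xs} \<le> 1 / 3"
    and "\<And>P. P \<in> distributions n \<Longrightarrow> No P \<Longrightarrow> measure_pmf.prob (replicate_pmf m P) {xs. acc xs} \<le> 1 / 3"
  shows "testable_with n m Yes No"
proof -
  let ?T = "\<lambda>xs. return_pmf (acc xs)"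
  have T: "pmf (bind_pmf (replicate_pmf m P) ?T) b = 1 - measure_pmf.prob (replicate_pmf m P) {xs. acc xs = (\<not> b)}" for P b
  proof -
    have "pmf (bind_pmf (replicate_pmf m P) ?T) b = measure_pmf.prob (replicate_pmf m P) (- {xs. acc xs = (\<not> b)})"
      unfolding map_pmf_def[symmetric] by (subst pmf_map) (auto intro!: arg_cong[where f = "measure_pmf.prob _"])
    then show ?thesis
      using measure_pmf.prob_compl[of "{xs. acc xs = (\<not> b)}" "replicate_pmf m P"] by (simp add: Compl_eq_Diff_UNIV)
  qed
  show ?thesis unfolding testable_with_def
  proof (intro exI[of _ ?T] ballI conjI impI)
    fix P assume P: "P \<in> distributions n"
    show "2 / 3 \<le> pmf (bind_pmf (replicate_pmf m P) ?T) True" if "Yes P"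
      using assms(1)[OF P that] by (simp add: T)
    show "2 / 3 \<le> pmf (bind_pmf (replicate_pmf m P) ?T) False" if "No P"
      using assms(2)[OF P that] by (simp add: T)
  qed
qed

section \<open>Sample sizes and the test for one graph\<close>

lemma real_nat_ceiling_le: "0 \<le> x \<Longrightarrow> real (nat \<lceil>x\<rceil>) \<le> x + 1"
  by linarith

text \<open>The constant is \<open>5 * 48 * 12\<close>: 5 from \<open>E_discrepancy_le\<close>, 48
  from the tolerated discrepancy, 12 for failure probability \<open>1 / 12\<close>. Rounding down
  suffices because that bound involves \<open>Suc k\<close>.\<close>

definition learn_size :: "nat \<Rightarrow> nat \<Rightarrow> real \<Rightarrow> nat" where
  "learn_size n d \<epsilon> = nat \<lfloor>2880 * real n ^ 2 * 2 ^ d / \<epsilon>\<^sup>2\<rfloor>"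

definition test_size :: "nat \<Rightarrow> real \<Rightarrow> nat" where
  "test_size n \<epsilon> = nat \<lceil>1000 * sqrt (2 ^ n) / \<epsilon>\<^sup>2\<rceil>"

definition total_size :: "nat \<Rightarrow> nat \<Rightarrow> real \<Rightarrow> nat" where
  "total_size n d \<epsilon> = n * learn_size n d \<epsilon> + (test_size n \<epsilon> + test_size n \<epsilon>)"

definition accepts :: "nat \<Rightarrow> nat \<Rightarrow> real \<Rightarrow> (nat \<times> nat) set \<Rightarrow> (nat \<Rightarrow> bool) list \<Rightarrow> bool" where
  "accepts n d \<epsilon> G xs =
     (let k = learn_size n d \<epsilon>; m = test_size n \<epsilon>;
          yss = chunks n k (take (n * k) xs); zs = drop (n * k) xs
      in identity_testing.verdict n \<epsilon> m (heavy n G yss) (learned n G yss) (take m zs) (drop m zs))"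

lemma finite_dag: "G \<in> dags n d \<Longrightarrow> finite G"
  unfolding dags_def by (auto intro: finite_subset)

text \<open>If \<open>P\<close> is Markov, learning fails with probability at most
  \<open>1 / 12\<close> and the identity test with at most \<open>1 / 6\<close>. In the far case the
  quality of learning is irrelevant: the learned net is Markov for every outcome of the batches,
  hence far from \<open>P\<close>.\<close>

lemma accepts_error:
  assumes n: "n \<ge> 1" and G: "G \<in> dags n d" and \<epsilon>: "0 < \<epsilon>" "\<epsilon> \<le> 1" and P: "P \<in> distributions n"
  shows "hellinger_graph n P G = 0 \<Longrightarrow>
           measure_pmf.prob (replicate_pmf (total_size n d \<epsilon>) P) {xs. \<not> accepts n d \<epsilon> G xs} \<le> 1 / 4"
    and "\<epsilon> \<le> hellinger_graph n P G \<Longrightarrow>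
           measure_pmf.prob (replicate_pmf (total_size n d \<epsilon>) P) {xs. accepts n d \<epsilon> G xs} \<le> 1 / 4"
proof -
  let ?k = "learn_size n d \<epsilon>" and ?m = "test_size n \<epsilon>"
  let ?L = "replicate_pmf n (replicate_pmf ?k P)"
  let ?PP = "pair_pmf (replicate_pmf ?m P) (replicate_pmf ?m P)"
  let ?v = "\<lambda>yss z. identity_testing.verdict n \<epsilon> ?m (heavy n G yss) (learned n G yss) (fst z) (snd z)"
  note finP = finite_distributions[OF P]
  note finL = finite_set_replicate_pmf[OF finite_set_replicate_pmf[OF finP]]
  have finPP: "finite (set_pmf ?PP)"
    by (simp add: finite_set_replicate_pmf finP)
  have Gf: "finite G" "acyclic G" using G finite_dag by (auto simp: dags_def)
  have it: "identity_testing n \<epsilon> ?m P (heavy n G yss) (learned n G yss)" for yss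
  proof
    interpret network G "learned_factor G yss" by (rule network_learned[OF Gf])
    show "heavy n G yss \<subseteq> cube n" by (auto simp: heavy_def)
    then show "0 < pmf (learned n G yss) x" if "x \<in> heavy n G yss" for x
      using that by (auto simp: learned_def pmf_net intro!: prod_pos pos)
    show "learned n G yss \<in> distributions n"
      unfolding learned_def by (rule net_in_distributions)
    show "1000 * sqrt (2 ^ n) / \<epsilon>\<^sup>2 \<le> real ?m"
      unfolding test_size_def by (rule real_nat_ceiling_ge)
  qed (use P \<epsilon> in auto)
  \<comment> \<open>Cutting the sample list makes the learning batches and the two test samples
    independent; \<open>R\<close> covers acceptance and rejection at once.\<close>
  have law: "measure_pmf.prob (replicate_pmf (total_size n d \<epsilon>) P) {xs. R (accepts n d \<epsilon> G xs)}
     = measure_pmf.prob (pair_pmf ?L ?PP) {yz. R (?v (fst yz) (snd yz))}" for R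
  proof -
    let ?f = "\<lambda>xs. (take (n * ?k) xs, drop (n * ?k) xs)"
    let ?g = "\<lambda>(ys, zs). (chunks n ?k ys, (take ?m zs, drop ?m zs))"
    have "pair_pmf ?L ?PP = map_pmf ?g (map_pmf ?f (replicate_pmf (total_size n d \<epsilon>) P))"
      unfolding total_size_def replicate_pmf_split map_pair map_chunks_replicate_pmf ..
    then show ?thesis
      by (simp add: map_pmf_comp measure_map_pmf vimage_def accepts_def Let_def)
  qed
  {
    assume "hellinger_graph n P G = 0"
    then have mk: "markov n G P" by (rule hellinger_graph_eq_0_imp_markov[OF Gf P])
    interpret learning n d G P ?k by standard (use n G P mk in auto)
    let ?Z = "\<lambda>yss. discrepancy n (heavy n G yss) P (learned n G yss)"
    have "measure_pmf.prob (pair_pmf ?L ?PP) {yz. \<not> ?v (fst yz) (snd yz)}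
       \<le> measure_pmf.prob ?L {yss. \<epsilon>\<^sup>2 / 48 \<le> ?Z yss} + 1 / 6"
    proof (rule prob_pair_le[OF finL finPP])
      fix yss assume "\<not> \<epsilon>\<^sup>2 / 48 \<le> ?Z yss"
      then show "measure_pmf.prob ?PP {z. \<not> ?v yss z} \<le> 1 / 6"
        by (intro identity_testing.verdict_complete[OF it]) auto
    qed simp
    also have "measure_pmf.prob ?L {yss. \<epsilon>\<^sup>2 / 48 \<le> ?Z yss} \<le> E ?L ?Z / (\<epsilon>\<^sup>2 / 48)"
      using \<epsilon> by (intro markov_ineq finL) (auto simp: discrepancy_def intro!: sum_nonneg)
    also have "\<dots> \<le> 1 / 12"
    proof -
      have "2880 * real n ^ 2 * 2 ^ d / \<epsilon>\<^sup>2 \<le> real (Suc ?k)"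
        unfolding learn_size_def by linarith
      then have "2880 * real n ^ 2 * 2 ^ d / \<epsilon>\<^sup>2 * E ?L ?Z \<le> real (Suc ?k) * E ?L ?Z"
        by (intro mult_right_mono E_nonneg) (auto simp: discrepancy_def intro!: sum_nonneg)
      also note E_discrepancy_le
      finally have "576 * (E ?L ?Z / \<epsilon>\<^sup>2) * (5 * real n ^ 2 * 2 ^ d) \<le> 1 * (5 * real n ^ 2 * 2 ^ d)"
        by (simp add: mult_ac)
      moreover have "0 < 5 * real n ^ 2 * 2 ^ d" using n by simp
      ultimately have "576 * (E ?L ?Z / \<epsilon>\<^sup>2) \<le> 1"
        by (rule mult_right_le_imp_le)
      then show ?thesis by simp
    qed
    finally show "measure_pmf.prob (replicate_pmf (total_size n d \<epsilon>) P) {xs. \<not> accepts n d \<epsilon> G xs} \<le> 1 / 4"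
      unfolding law[of Not] by simp
  }
  {
    assume far: "\<epsilon> \<le> hellinger_graph n P G"
    have "measure_pmf.prob (pair_pmf ?L ?PP) {yz. ?v (fst yz) (snd yz)} \<le> measure_pmf.prob ?L {yss. False} + 1 / 6"
    proof (rule prob_pair_le[OF finL finPP])
      fix yss
      interpret network G "learned_factor G yss" by (rule network_learned[OF Gf])
      have "hellinger_graph n P G \<le> hellinger n P (learned n G yss)"
        unfolding learned_def by (intro hellinger_graph_le net_in_distributions markov_net)
      with far show "measure_pmf.prob ?PP {z. ?v yss z} \<le> 1 / 6"
        by (intro identity_testing.verdict_sound[OF it]) auto
    qed simp
    then show "measure_pmf.prob (replicate_pmf (total_size n d \<epsilon>) P) {xs. accepts n d \<epsilon> G xs} \<le> 1 / 4"
      unfolding law[of "\<lambda>b. b"] by simp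
  }
qed

section \<open>Comparison with the claimed bound\<close>

lemma sample_bound_nonneg: "0 \<le> sample_bound n d \<epsilon>"
  unfolding sample_bound_def by (simp add: le_max_iff_disj)

text \<open>For small in-degree the term $2^{n/2}$ absorbs every polynomial factor, and for
  \<open>4 * d > n\<close> the factor \<open>d\<close> replaces a factor \<open>n\<close>.\<close>
lemma cube_mult_power_le:
  assumes n: "n \<ge> 2"
  shows "real n ^ 3 * 2 ^ d \<le> 5832 * max (2 powr (real n / 2)) (2 ^ d * (real n)\<^sup>2 * real d * ln (real n))"
proof (cases "4 * d \<le> n")
  case True
  \<comment> \<open>One third of the exponent \<open>n / 4\<close> is used per factor
    \<open>n\<close>; with \<open>ln 2\<close> at least \<open>2 / 3\<close> the loss is 18 per
    factor, and \<open>18 ^ 3 = 5832\<close>.\<close>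
  have "(1 + ln 2 * real n / 12) \<le> exp (ln 2 * real n / 12)" by (rule exp_ge_add_one_self)
  moreover have "real n / 18 \<le> ln 2 * real n / 12"
    using mult_right_mono[OF ln2_ge_two_thirds, of "real n"] by simp
  ultimately have "real n / 18 \<le> exp (ln 2 * real n / 12)" by linarith
  then have "(real n / 18) ^ 3 \<le> exp (ln 2 * real n / 12) ^ 3" by (intro power_mono) auto
  also have "\<dots> = 2 powr (real n / 4)" by (simp add: powr_def exp_of_nat_mult[symmetric])
  finally have "real n ^ 3 \<le> 5832 * 2 powr (real n / 4)" by (simp add: power_divide)
  moreover have "(2::real) ^ d \<le> 2 powr (real n / 4)"
    using True by (subst powr_realpow[symmetric]) auto
  ultimately have "real n ^ 3 * 2 ^ d \<le> 5832 * 2 powr (real n / 4) * 2 powr (real n / 4)"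
    by (intro mult_mono) auto
  also have "\<dots> = 5832 * 2 powr (real n / 2)" by (simp flip: powr_add)
  also have "\<dots> \<le> 5832 * max (2 powr (real n / 2)) (2 ^ d * (real n)\<^sup>2 * real d * ln (real n))" by simp
  finally show ?thesis .
next
  case False
  have "ln 2 \<le> ln (real n)" using n by simp
  with ln2_ge_two_thirds have "2 / 3 \<le> ln (real n)" by linarith
  then have "real d * (2 / 3) \<le> real d * ln (real n)" by (intro mult_left_mono) auto
  moreover have "real n \<le> 4 * real d" using False by simp
  ultimately have "real n \<le> 6 * (real d * ln (real n))" by linarith
  then have "(real n)\<^sup>2 * 2 ^ d * real n \<le> (real n)\<^sup>2 * 2 ^ d * (6 * (real d * ln (real n)))"
    by (intro mult_left_mono) auto
  also have "\<dots> \<le> 5832 * (2 ^ d * (real n)\<^sup>2 * real d * ln (real n))" using n by (simp add: mult_ac)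
  also have "\<dots> \<le> 5832 * max (2 powr (real n / 2)) (2 ^ d * (real n)\<^sup>2 * real d * ln (real n))" by simp
  also have "(real n)\<^sup>2 * 2 ^ d * real n = real n ^ 3 * 2 ^ d" by (simp add: power2_eq_square power3_eq_cube)
  finally show ?thesis .
qed

lemma total_size_le:
  assumes n: "n \<ge> 2" and \<epsilon>: "0 < \<epsilon>" "\<epsilon> \<le> 1"
  shows "real (total_size n d \<epsilon>) \<le> 2 * 10 ^ 7 * sample_bound n d \<epsilon>"
proof -
  define M where "M = max (2 powr (real n / 2)) (2 ^ d * (real n)\<^sup>2 * real d * ln (real n))"
  have e2: "0 < \<epsilon>\<^sup>2" "\<epsilon>\<^sup>2 \<le> 1" using \<epsilon> by (auto simp: power_le_one)
  have sb: "sample_bound n d \<epsilon> = M / \<epsilon>\<^sup>2"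
    unfolding sample_bound_def M_def using e2 by (simp add: max_def divide_le_cancel)
  have sq: "sqrt (2 ^ n) = 2 powr (real n / 2)"
    by (simp add: powr_half_sqrt[symmetric] powr_realpow[symmetric] powr_powr)
  have "real (learn_size n d \<epsilon>) \<le> 2880 * real n ^ 2 * 2 ^ d / \<epsilon>\<^sup>2"
    unfolding learn_size_def by (intro of_nat_floor) auto
  then have "real n * real (learn_size n d \<epsilon>) \<le> real n * (2880 * real n ^ 2 * 2 ^ d / \<epsilon>\<^sup>2)"
    by (intro mult_left_mono) auto
  also have "\<dots> = 2880 * (real n ^ 3 * 2 ^ d) / \<epsilon>\<^sup>2" by (simp add: power2_eq_square power3_eq_cube)
  also have "\<dots> \<le> 2880 * (5832 * M) / \<epsilon>\<^sup>2"
    unfolding M_def using e2 by (intro divide_right_mono mult_left_mono cube_mult_power_le n) auto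
  finally have 1: "real n * real (learn_size n d \<epsilon>) \<le> 16796160 * (M / \<epsilon>\<^sup>2)" by simp
  have "1 \<le> 2 powr (real n / 2)" by (intro ge_one_powr_ge_zero) auto
  \<comment> \<open>This absorbs the additive 1 from rounding up the test size.\<close>
  then have M1: "1 \<le> M / \<epsilon>\<^sup>2" using e2 by (simp add: M_def le_divide_eq le_max_iff_disj)
  have t: "real (test_size n \<epsilon>) \<le> 1000 * sqrt (2 ^ n) / \<epsilon>\<^sup>2 + 1"
    unfolding test_size_def by (intro real_nat_ceiling_le) auto
  have "1000 * sqrt (2 ^ n) / \<epsilon>\<^sup>2 \<le> 1000 * (M / \<epsilon>\<^sup>2)"
    unfolding sq using e2 by (simp add: M_def divide_right_mono)
  with t M1 have 2: "real (test_size n \<epsilon>) \<le> 1001 * (M / \<epsilon>\<^sup>2)" by linarith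
  show ?thesis
    unfolding sb total_size_def using 1 2 M1 by simp
qed

section \<open>Counting graphs of bounded in-degree\<close>

lemma card_bounded_subsets_le:
  assumes "i \<in> {1..n}"
  shows "card {S. S \<subseteq> {1..n} - {i} \<and> card S \<le> d} \<le> n ^ d"
proof -
  \<comment> \<open>The excluded point \<open>i\<close> serves as padding: a set with fewer than
    \<open>d\<close> elements is listed by a function that takes the value \<open>i\<close> at the
    remaining arguments.\<close>
  have "{S. S \<subseteq> {1..n} - {i} \<and> card S \<le> d} \<subseteq> (\<lambda>g. g ` {..<d} - {i}) ` ({..<d} \<rightarrow>\<^sub>E {1..n})"
  proof
    fix S assume "S \<in> {S. S \<subseteq> {1..n} - {i} \<and> card S \<le> d}"
    then have S: "S \<subseteq> {1..n} - {i}" "card S \<le> d" by auto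
    have "finite S" using S(1) finite_subset by blast
    then obtain h where h: "bij_betw h {0..<card S} S" using ex_bij_betw_nat_finite by blast
    define g where "g = (\<lambda>j\<in>{..<d}. if j < card S then h j else i)"
    have hS: "h ` {0..<card S} = S" using h by (simp add: bij_betw_def)
    have "h j \<in> {1..n}" if "j < card S" for j
    proof -
      have "h j \<in> S" using hS that by auto
      with S(1) show ?thesis by blast
    qed
    then have "g \<in> {..<d} \<rightarrow>\<^sub>E {1..n}"
      unfolding g_def restrict_PiE_iff using assms by auto
    moreover have "S = g ` {..<d} - {i}"
    proof
      show "S \<subseteq> g ` {..<d} - {i}"
      proof
        fix s assume s: "s \<in> S"
        with hS have "s \<in> h ` {0..<card S}" by simp
        then obtain j where "j < card S" "s = h j" by auto
        then have "s = g j" "j < d" using S(2) by (auto simp: g_def)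
        then show "s \<in> g ` {..<d} - {i}" using s S(1) by auto
      qed
    qed (use hS in \<open>auto simp: g_def split: if_splits\<close>)
    ultimately show "S \<in> (\<lambda>g. g ` {..<d} - {i}) ` ({..<d} \<rightarrow>\<^sub>E {1..n})" by blast
  qed
  then have "card {S. S \<subseteq> {1..n} - {i} \<and> card S \<le> d} \<le> card ({..<d} \<rightarrow>\<^sub>E {1..n})"
    by (intro surj_card_le finite_PiE) auto
  then show ?thesis by (simp add: card_PiE)
qed

lemma finite_dags: "finite (dags n d)"
  by (rule finite_subset[of _ "Pow ({1..n} \<times> {1..n})"]) (auto simp: dags_def)

text \<open>A graph is determined by its parent sets, and by acyclicity the parent set of
  \<open>i\<close> avoids \<open>i\<close>, leaving at most \<open>n ^ d\<close> choices per
  node.\<close>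

lemma card_dags_le: "card (dags n d) \<le> n ^ (d * n)"
proof -
  let ?F = "\<Pi>\<^sub>E i\<in>{1..n}. {S. S \<subseteq> {1..n} - {i} \<and> card S \<le> d}"
  have "card (dags n d) \<le> card ?F"
  proof (rule card_inj_on_le)
    show "inj_on (\<lambda>G. \<lambda>i\<in>{1..n}. parents G i) (dags n d)"
    proof (rule inj_onI)
      fix G H assume GH: "G \<in> dags n d" "H \<in> dags n d"
        "(\<lambda>i\<in>{1..n}. parents G i) = (\<lambda>i\<in>{1..n}. parents H i)"
      have "parents G i = parents H i" if "i \<in> {1..n}" for i
        using fun_cong[OF GH(3), of i] that by simp
      then have "(j, i) \<in> G \<longleftrightarrow> (j, i) \<in> H" if "i \<in> {1..n}" for i j
        using that unfolding parents_def by blast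
      then show "G = H" using GH(1,2) unfolding dags_def by auto
    qed
    show "(\<lambda>G. \<lambda>i\<in>{1..n}. parents G i) ` dags n d \<subseteq> ?F"
    proof (intro image_subsetI)
      fix G assume G: "G \<in> dags n d"
      have "i \<notin> parents G i" for i using G unfolding dags_def acyclic_def parents_def by auto
      then show "(\<lambda>i\<in>{1..n}. parents G i) \<in> ?F"
        using G unfolding restrict_PiE_iff dags_def by (auto simp: parents_def)
    qed
    show "finite ?F" by (intro finite_PiE) auto
  qed
  also have "card ?F = (\<Prod>i\<in>{1..n}. card {S. S \<subseteq> {1..n} - {i} \<and> card S \<le> d})"
    by (rule card_PiE) simp
  also have "\<dots> \<le> (\<Prod>i\<in>{1..n}. n ^ d)"
    by (intro prod_mono conjI card_bounded_subsets_le) auto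
  also have "\<dots> = n ^ (d * n)" by (simp add: power_mult)
  finally show ?thesis .
qed

text \<open>The logarithm in the bounds vanishes at \<open>n = 1\<close>. There the only node has no
  parent, so every distribution is Markov and a tester can accept without samples.\<close>

lemma hellinger_graph_single:
  assumes G: "G \<in> dags 1 d" and P: "P \<in> distributions 1"
  shows "hellinger_graph 1 P G \<le> 0"
proof -
  have p: "parents G 1 = {}"
    using G unfolding dags_def acyclic_def parents_def by auto
  have "markov 1 G P" unfolding markov_def
  proof
    fix x assume x: "x \<in> cube 1"
    have "measure_pmf.prob P {y. y 1 = x 1} = (\<Sum>y\<in>cube 1. pmf P y * of_bool (y 1 = x 1))"
      unfolding prob_conv_E using P by (intro E_conv_sum) (auto simp: distributions_def)
    also have "\<dots> = (\<Sum>y\<in>cube 1. if y = x then pmf P y else 0)"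
    proof (intro sum.cong refl)
      fix y assume y: "y \<in> cube 1"
      have "y = x" if "y 1 = x 1"
        using x y that unfolding cube_def by (intro PiE_ext[of y "{1..1}"]) auto
      then show "pmf P y * of_bool (y 1 = x 1) = (if y = x then pmf P y else 0)" by auto
    qed
    also have "\<dots> = pmf P x" using x by simp
    finally show "pmf P x = (\<Prod>i\<in>{1..1}. \<P>(y in measure_pmf P. y i = x i \<bar>
        restrict y (parents G i) = restrict x (parents G i)))"
      by (simp add: cond_prob_def p[simplified] restrict_def)
  qed
  from hellinger_graph_le[OF P this, of P] show ?thesis by (simp add: hellinger_def)
qed

section \<open>Majority vote and union bound\<close>

definition amplified :: "nat \<Rightarrow> nat \<Rightarrow> nat \<Rightarrow> real \<Rightarrow> (nat \<times> nat) set \<Rightarrow> (nat \<Rightarrow> bool) list \<Rightarrow> bool" where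
  "amplified r n d \<epsilon> G xs \<longleftrightarrow> r < 2 * hits (accepts n d \<epsilon> G) (chunks r (total_size n d \<epsilon>) xs)"

text \<open>A tied vote rejects, but \<open>majority_error\<close> counts ties as errors and so
  serves both directions.\<close>

lemma amplified_error:
  assumes n: "n \<ge> 1" and G: "G \<in> dags n d" and \<epsilon>: "0 < \<epsilon>" "\<epsilon> \<le> 1" and P: "P \<in> distributions n"
  shows "hellinger_graph n P G = 0 \<Longrightarrow>
           measure_pmf.prob (replicate_pmf (r * total_size n d \<epsilon>) P) {xs. \<not> amplified r n d \<epsilon> G xs} \<le> (7 / 8) ^ r"
    and "\<epsilon> \<le> hellinger_graph n P G \<Longrightarrow>
           measure_pmf.prob (replicate_pmf (r * total_size n d \<epsilon>) P) {xs. amplified r n d \<epsilon> G xs} \<le> (7 / 8) ^ r"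
proof -
  let ?p = "replicate_pmf (total_size n d \<epsilon>) P"
  have fin: "finite (set_pmf ?p)" by (intro finite_set_replicate_pmf finite_distributions[OF P])
  have law: "measure_pmf.prob (replicate_pmf (r * total_size n d \<epsilon>) P) {xs. R (chunks r (total_size n d \<epsilon>) xs)}
     = measure_pmf.prob (replicate_pmf r ?p) {xss. R xss}" for R
    by (simp add: vimage_def flip: map_chunks_replicate_pmf)
  let ?a = "accepts n d \<epsilon> G"
  {
    assume "hellinger_graph n P G = 0"
    note err = accepts_error(1)[OF n G \<epsilon> P this]
    have len: "hits ?a xss + hits (\<lambda>xs. \<not> ?a xs) xss = length xss" for xss
      by (rule sum_length_filter_compl)
    have "measure_pmf.prob (replicate_pmf r ?p) {xss. \<not> r < 2 * hits ?a xss}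
        \<le> measure_pmf.prob (replicate_pmf r ?p) {xss. r \<le> 2 * hits (\<lambda>xs. \<not> ?a xs) xss}"
      unfolding prob_conv_E
    proof (intro E_mono finite_set_replicate_pmf[OF fin])
      fix xss assume "xss \<in> set_pmf (replicate_pmf r ?p)"
      then have "length xss = r" by (simp add: set_replicate_pmf)
      with len[of xss] show "of_bool (\<not> r < 2 * hits ?a xss) \<le> (of_bool (r \<le> 2 * hits (\<lambda>xs. \<not> ?a xs) xss) :: real)"
        by auto
    qed
    also have "\<dots> \<le> (7 / 8) ^ r" by (rule majority_error[OF fin err])
    finally show "measure_pmf.prob (replicate_pmf (r * total_size n d \<epsilon>) P) {xs. \<not> amplified r n d \<epsilon> G xs} \<le> (7 / 8) ^ r"
      unfolding amplified_def law[of "\<lambda>xss. \<not> r < 2 * hits ?a xss"] .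
  }
  {
    assume "\<epsilon> \<le> hellinger_graph n P G"
    note err = accepts_error(2)[OF n G \<epsilon> P this]
    have "measure_pmf.prob (replicate_pmf r ?p) {xss. r < 2 * hits ?a xss}
        \<le> measure_pmf.prob (replicate_pmf r ?p) {xss. r \<le> 2 * hits ?a xss}"
      by (intro measure_pmf.finite_measure_mono) auto
    also have "\<dots> \<le> (7 / 8) ^ r" by (rule majority_error[OF fin err])
    finally show "measure_pmf.prob (replicate_pmf (r * total_size n d \<epsilon>) P) {xs. amplified r n d \<epsilon> G xs} \<le> (7 / 8) ^ r"
      unfolding amplified_def law[of "\<lambda>xss. r < 2 * hits ?a xss"] .
  }
qed

text \<open>As \<open>7 / 8\<close> is at most \<open>exp (- 1 / 8)\<close>,
  \<open>16 * ln N\<close> repetitions bring the error down to \<open>1 / N^2\<close>, which is at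
  most \<open>1 / (3 N)\<close>. Since \<open>ln N\<close> is at least 1, rounding up costs at most
  one more \<open>ln N\<close>.\<close>

lemma repetitions:
  assumes "3 \<le> (N::real)"
  shows "\<exists>r. real r \<le> 17 * ln N \<and> N * (7 / 8) ^ r \<le> 1 / 3"
proof (intro exI conjI)
  let ?r = "nat \<lceil>16 * ln N\<rceil>"
  have ln3: "ln 3 \<le> ln N" using assms by simp
  have "exp 1 \<le> (3::real)" using exp_le by simp
  then have "1 \<le> ln (3::real)" by (simp add: ln_ge_iff)
  with ln3 have L: "1 \<le> ln N" by simp
  have "real ?r \<le> 16 * ln N + 1" using L by (intro real_nat_ceiling_le) auto
  with L show "real ?r \<le> 17 * ln N" by linarith
  have "(7 / 8 :: real) \<le> exp (- 1 / 8)" using exp_ge_add_one_self[of "- 1 / 8"] by simp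
  then have "(7 / 8 :: real) ^ ?r \<le> exp (- 1 / 8) ^ ?r" by (intro power_mono) auto
  also have "\<dots> = exp (- real ?r / 8)" by (simp add: exp_of_nat_mult[symmetric])
  also have "\<dots> \<le> exp (- (ln N + ln 3))"
  proof -
    have "16 * ln N \<le> real ?r" by (rule real_nat_ceiling_ge)
    then show ?thesis using ln3 by simp
  qed
  also have "\<dots> = 1 / (3 * N)" using assms by (simp add: exp_diff exp_minus field_simps)
  finally have "N * (7 / 8) ^ ?r \<le> N * (1 / (3 * N))" using assms by (intro mult_left_mono) auto
  then show "N * (7 / 8) ^ ?r \<le> 1 / 3" using assms by simp
qed

lemma graph_testable:
  assumes n: "n \<ge> 1" and \<epsilon>: "0 < \<epsilon>" "\<epsilon> \<le> 1" and G: "G \<in> dags n d"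
  shows "\<exists>m::nat. real m \<le> 2 * 10 ^ 7 * sample_bound n d \<epsilon> \<and>
     testable_with n m (\<lambda>P. hellinger_graph n P G = 0) (\<lambda>P. hellinger_graph n P G \<ge> \<epsilon>)"
proof (cases "n = 1")
  case True
  have "testable_with n 0 (\<lambda>P. hellinger_graph n P G = 0) (\<lambda>P. hellinger_graph n P G \<ge> \<epsilon>)"
    using hellinger_graph_single G True \<epsilon>(1) by (intro testable_withI[where acc = "\<lambda>_. True"]) force+
  then show ?thesis using sample_bound_nonneg by (intro exI[of _ 0]) auto
next
  case False
  have "testable_with n (total_size n d \<epsilon>) (\<lambda>P. hellinger_graph n P G = 0) (\<lambda>P. hellinger_graph n P G \<ge> \<epsilon>)"
    using accepts_error[OF n G \<epsilon>] by (intro testable_withI[where acc = "accepts n d \<epsilon> G"]) force+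
  then show ?thesis using total_size_le n False \<epsilon> by (intro exI[of _ "total_size n d \<epsilon>"]) auto
qed

text \<open>The same samples serve all graphs, and one accepting vote suffices. Completeness needs
  only the vote of the right graph; soundness is a union bound over all graphs, which fixes the
  number of repetitions.\<close>

lemma some_graph_testable:
  assumes n: "n \<ge> 1" and d: "d \<ge> 1" and \<epsilon>: "0 < \<epsilon>" "\<epsilon> \<le> 1"
  shows "\<exists>m::nat. real m \<le> 34 * 10 ^ 7 * (sample_bound n d \<epsilon> * ln (real n ^ (d * n))) \<and>
     testable_with n m (\<lambda>P. \<exists>G\<in>dags n d. hellinger_graph n P G = 0) (\<lambda>P. \<forall>G\<in>dags n d. hellinger_graph n P G \<ge> \<epsilon>)"
proof (cases "n = 1")
  case True
  have "{} \<in> dags n d" by (auto simp: dags_def parents_def acyclic_def)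
  then have "testable_with n 0 (\<lambda>P. \<exists>G\<in>dags n d. hellinger_graph n P G = 0) (\<lambda>P. \<forall>G\<in>dags n d. hellinger_graph n P G \<ge> \<epsilon>)"
    using hellinger_graph_single True \<epsilon>(1) by (intro testable_withI[where acc = "\<lambda>_. True"]) force+
  then show ?thesis using True by (intro exI[of _ 0]) auto
next
  case False
  let ?N = "real n ^ (d * n)"
  have n2: "n \<ge> 2" using n False by simp
  have "2 \<le> d * n" using n2 d mult_le_mono[of 1 d 2 n] by simp
  then have "(2::real) ^ 2 \<le> 2 ^ (d * n)" by (intro power_increasing) auto
  also have "\<dots> \<le> ?N" using n2 by (intro power_mono) auto
  finally have N: "3 \<le> ?N" by simp
  then obtain r where r: "real r \<le> 17 * ln ?N" "?N * (7 / 8) ^ r \<le> 1 / 3"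
    using repetitions by blast
  let ?M = "total_size n d \<epsilon>"
  have "real (r * ?M) \<le> 17 * ln ?N * (2 * 10 ^ 7 * sample_bound n d \<epsilon>)"
    unfolding of_nat_mult using r(1) total_size_le[OF n2 \<epsilon>] N by (intro mult_mono) auto
  then have "real (r * ?M) \<le> 34 * 10 ^ 7 * (sample_bound n d \<epsilon> * ln ?N)" by (simp add: mult_ac)
  moreover have "testable_with n (r * ?M) (\<lambda>P. \<exists>G\<in>dags n d. hellinger_graph n P G = 0)
     (\<lambda>P. \<forall>G\<in>dags n d. hellinger_graph n P G \<ge> \<epsilon>)"
  proof (rule testable_withI[where acc = "\<lambda>xs. \<exists>G\<in>dags n d. amplified r n d \<epsilon> G xs"])
    fix P assume P: "P \<in> distributions n" and "\<exists>G\<in>dags n d. hellinger_graph n P G = 0"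
    then obtain G where G: "G \<in> dags n d" "hellinger_graph n P G = 0" by blast
    have "measure_pmf.prob (replicate_pmf (r * ?M) P) {xs. \<not> (\<exists>G\<in>dags n d. amplified r n d \<epsilon> G xs)}
       \<le> measure_pmf.prob (replicate_pmf (r * ?M) P) {xs. \<not> amplified r n d \<epsilon> G xs}"
      using G(1) by (intro measure_pmf.finite_measure_mono) auto
    also have "\<dots> \<le> (7 / 8) ^ r" by (rule amplified_error(1)[OF n G(1) \<epsilon> P G(2)])
    also have "\<dots> \<le> ?N * (7 / 8) ^ r" using N by simp
    also note r(2)
    finally show "measure_pmf.prob (replicate_pmf (r * ?M) P) {xs. \<not> (\<exists>G\<in>dags n d. amplified r n d \<epsilon> G xs)} \<le> 1 / 3" .
  next
    fix P assume P: "P \<in> distributions n" and far: "\<forall>G\<in>dags n d. \<epsilon> \<le> hellinger_graph n P G"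
    let ?pr = "measure_pmf.prob (replicate_pmf (r * ?M) P)"
    have "{xs. \<exists>G\<in>dags n d. amplified r n d \<epsilon> G xs} = (\<Union>G\<in>dags n d. {xs. amplified r n d \<epsilon> G xs})" by auto
    then have "?pr {xs. \<exists>G\<in>dags n d. amplified r n d \<epsilon> G xs} \<le> (\<Sum>G\<in>dags n d. ?pr {xs. amplified r n d \<epsilon> G xs})"
      using measure_pmf.finite_measure_subadditive_finite[OF finite_dags] by simp
    also have "\<dots> \<le> (\<Sum>G\<in>dags n d. (7 / 8) ^ r)"
      using far by (intro sum_mono amplified_error(2)[OF n _ \<epsilon> P]) auto
    also have "\<dots> = real (card (dags n d)) * (7 / 8) ^ r" by simp
    also have "\<dots> \<le> ?N * (7 / 8) ^ r"
      using card_dags_le[of n d] by (intro mult_right_mono) (auto simp flip: of_nat_power)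
    also note r(2)
    finally show "?pr {xs. \<exists>G\<in>dags n d. amplified r n d \<epsilon> G xs} \<le> 1 / 3" .
  qed
  ultimately show ?thesis by blast
qed

theorem theorem5p1:
  shows "(\<exists>C>0. \<forall>(n::nat) (d::nat) (\<epsilon>::real) G.
            n \<ge> 1 \<longrightarrow> 0 < \<epsilon> \<longrightarrow> \<epsilon> \<le> 1 \<longrightarrow> G \<in> dags n d \<longrightarrow>
            (\<exists>m::nat. real m \<le> C * sample_bound n d \<epsilon> \<and>
               testable_with n m
                 (\<lambda>P. hellinger_graph n P G = 0)
                 (\<lambda>P. hellinger_graph n P G \<ge> \<epsilon>))) \<and>
         (\<exists>C>0. \<forall>(n::nat) (d::nat) (\<epsilon>::real).
            n \<ge> 1 \<longrightarrow> d \<ge> 1 \<longrightarrow> 0 < \<epsilon> \<longrightarrow> \<epsilon> \<le> 1 \<longrightarrow>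
            (\<exists>m::nat. real m \<le> C * (sample_bound n d \<epsilon> * ln (real n ^ (d * n))) \<and>
               testable_with n m
                 (\<lambda>P. \<exists>G\<in>dags n d. hellinger_graph n P G = 0)
                 (\<lambda>P. \<forall>G\<in>dags n d. hellinger_graph n P G \<ge> \<epsilon>)))"
  by (intro conjI exI[of _ "2 * 10 ^ 7"] exI[of _ "34 * 10 ^ 7"] allI impI graph_testable some_graph_testable) simp_all

end
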